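(* Let $s\in[0,1]$, and let $V_k$, $\Lambda_k$, $Q_k$, $P^s_{k,k-1}$ ($k=1,\dots,J$) and $V_h=V_J$, $\Lambda_h=\Lambda_J$ be as defined in the context. For each $k=1,\dots,J$ let $R^s_k:V_k\to V_k$ be a symmetric positive definite operator, and suppose there are constants $C_1,C_2>0$ independent of $k$ such that for each $k=1,\dots,J$ and every $\tau\in V_k$ $$(R^s_k\tau,\tau)\le C_1(\Lambda_k^{-s}\tau,\tau)$$ and $$\big((R^s_k)^{-1}(I-P^s_{k,k-1})\tau,(I-P^s_{k,k-1})\tau\big)\le C_2\big(\Lambda_k^s(I-P^s_{k,k-1})\tau,(I-P^s_{k,k-1})\tau\big).$$ Define $B^s_{\mathrm{div},h}:V_h\to V_h$ by $B^s_{\mathrm{div},h}=\sum_{k=1}^JR^s_kQ_k$. Then for every $\tau\in V_h$ $$C_2^{-1}(\Lambda_h^s\tau,\tau)\le (B^s_{\mathrm{div},h}\Lambda_h^s\tau,\Lambda_h^s\tau)\le C_1J(\Lambda_h^s\tau,\tau).$$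
   Context: $\Omega\subset\mathbb{R}^n$ is a bounded polygonal domain and $(\cdot,\cdot)$ is the $L^2(\Omega)$ inner product. $\mathcal{T}_1\subset\cdots\subset\mathcal{T}_J=\mathcal{T}_h$ is a sequence of shape-regular triangulations of $\Omega$, each obtained by refinement of the previous one, $\mathcal{T}_k$ having characteristic mesh size $h_k$, with $h_{k-1}\le\gamma h_k$ for $k=2,\dots,J$ and some constant $\gamma\ge1$. For a fixed integer $r\ge0$, $V_k=\mathcal{RT}_r(\mathcal{T}_k)\subset H(\mathrm{div};\Omega)$ is the Raviart-Thomas space of index $r$ on $\mathcal{T}_k$, so $V_1\subset\cdots\subset V_J=V_h$. $\Lambda_k:V_k\to V_k$ is defined by $(\Lambda_k\sigma,\tau)=(\sigma,\tau)+(\mathrm{div}\,\sigma,\mathrm{div}\,\tau)$ for $\sigma,\tau\in V_k$; $\Lambda_h=\Lambda_J$. Fractional powers $\Lambda_k^\theta$, $\theta\in\mathbb{R}$, are defined by spectral decomposition, and symmetry is with respect to $(\cdot,\cdot)$. $Q_k:V_h\to V_k$ is the $L^2$-orthogonal projection. For $k\ge2$, $P^s_{k,k-1}:V_k\to V_{k-1}$ is defined by $(\Lambda_{k-1}^sP^s_{k,k-1}\sigma,\tau)=(\Lambda_k^s\sigma,\tau)$ for $\sigma\in V_k$, $\tau\in V_{k-1}$, and $P^s_{1,0}=0$. *)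

theory Defs
  imports "HOL-Analysis.Analysis"
begin

section \<open>The Hilbert space of square integrable functions\<close>

text \<open>
  Elements of \<open>('a, 'b) l2\<close> are classes, modulo equality almost everywhere, of square integrable
  functions from \<open>'a\<close> to \<open>'b\<close>. Every Lebesgue measurable function agrees almost everywhere with
  a Borel one, so using \<^term>\<open>lborel\<close> loses no class.
\<close>

definition sq_integrable :: "('a::euclidean_space \<Rightarrow> 'b::euclidean_space) \<Rightarrow> bool" where
  "sq_integrable f \<longleftrightarrow> f \<in> borel_measurable lborel \<and> integrable lborel (\<lambda>x. (norm (f x))\<^sup>2)"

definition l2_eq :: "('a::euclidean_space \<Rightarrow> 'b::euclidean_space) \<Rightarrow> ('a \<Rightarrow> 'b) \<Rightarrow> bool" where
  "l2_eq f g \<longleftrightarrow> sq_integrable f \<and> sq_integrable g \<and> (AE x in lborel. f x = g x)"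

lemma sq_integrable_measurable [measurable_dest]:
  "sq_integrable f \<Longrightarrow> f \<in> borel_measurable lborel"
  by (simp add: sq_integrable_def)

lemma sq_integrable_zero: "sq_integrable (\<lambda>_. 0)"
  by (simp add: sq_integrable_def)

lemma sq_integrable_add:
  assumes f: "sq_integrable f" and g: "sq_integrable g"
  shows "sq_integrable (\<lambda>x. f x + g x)"
proof -
  have [measurable]: "f \<in> borel_measurable lborel" "g \<in> borel_measurable lborel"
    using f g by (auto simp: sq_integrable_def)
  have "integrable lborel (\<lambda>x. 2 * (norm (f x))\<^sup>2 + 2 * (norm (g x))\<^sup>2)"
    using f g by (auto simp: sq_integrable_def)
  then have "integrable lborel (\<lambda>x. (norm (f x + g x))\<^sup>2)"
  proof (rule Bochner_Integration.integrable_bound)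
    show "(\<lambda>x. (norm (f x + g x))\<^sup>2) \<in> borel_measurable lborel" by measurable
    have "(norm (f x + g x))\<^sup>2 \<le> 2 * (norm (f x))\<^sup>2 + 2 * (norm (g x))\<^sup>2" for x
    proof -
      have "(norm (f x + g x))\<^sup>2 \<le> (norm (f x) + norm (g x))\<^sup>2"
        by (intro power_mono norm_triangle_ineq) auto
      also have "\<dots> \<le> 2 * (norm (f x))\<^sup>2 + 2 * (norm (g x))\<^sup>2"
        using sum_squares_bound[of "norm (f x)" "norm (g x)"] by (simp add: power2_sum)
      finally show ?thesis .
    qed
    then show "AE x in lborel. norm ((norm (f x + g x))\<^sup>2)
        \<le> norm (2 * (norm (f x))\<^sup>2 + 2 * (norm (g x))\<^sup>2)"
      by auto
  qed
  then show ?thesis by (simp add: sq_integrable_def)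
qed

lemma sq_integrable_scaleR:
  assumes f: "sq_integrable f" shows "sq_integrable (\<lambda>x. c *\<^sub>R f x)"
  using f by (auto simp: sq_integrable_def power_mult_distrib)

lemma sq_integrable_inner:
  assumes f: "sq_integrable f" and g: "sq_integrable g"
  shows "integrable lborel (\<lambda>x. f x \<bullet> g x)"
proof -
  have [measurable]: "f \<in> borel_measurable lborel" "g \<in> borel_measurable lborel"
    using f g by (auto simp: sq_integrable_def)
  have "integrable lborel (\<lambda>x. (norm (f x))\<^sup>2 + (norm (g x))\<^sup>2)"
    using f g by (auto simp: sq_integrable_def)
  then show ?thesis
  proof (rule Bochner_Integration.integrable_bound)
    show "(\<lambda>x. f x \<bullet> g x) \<in> borel_measurable lborel" by measurable
    have "\<bar>f x \<bullet> g x\<bar> \<le> (norm (f x))\<^sup>2 + (norm (g x))\<^sup>2" for x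
    proof -
      have "\<bar>f x \<bullet> g x\<bar> \<le> norm (f x) * norm (g x)" by (rule Cauchy_Schwarz_ineq2)
      also have "\<dots> \<le> 2 * norm (f x) * norm (g x)" by simp
      also have "\<dots> \<le> (norm (f x))\<^sup>2 + (norm (g x))\<^sup>2" by (rule sum_squares_bound)
      finally show ?thesis .
    qed
    then show "AE x in lborel. norm (f x \<bullet> g x) \<le> norm ((norm (f x))\<^sup>2 + (norm (g x))\<^sup>2)"
      by auto
  qed
qed

quotient_type (overloaded) ('a, 'b) l2 = "'a::euclidean_space \<Rightarrow> 'b::euclidean_space" / partial: l2_eq
proof (rule part_equivpI)
  show "\<exists>x. l2_eq x x"
    using sq_integrable_zero by (auto simp: l2_eq_def)
  show "symp l2_eq" by (auto simp: symp_def l2_eq_def elim: AE_mp)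
  show "transp l2_eq"
    unfolding transp_def l2_eq_def by (auto elim!: AE_mp)
qed

text \<open>\<open>rep_l2 f\<close> is an arbitrarily chosen member of the class \<open>f\<close>.\<close>

lemma l2_eq_rep_l2: "l2_eq (rep_l2 f) (rep_l2 f)"
  using Quotient3_rep_reflp[OF Quotient3_l2] .

lemma abs_rep_l2: "abs_l2 (rep_l2 f) = f"
  using Quotient3_abs_rep[OF Quotient3_l2] .

instantiation l2 :: (euclidean_space, euclidean_space) real_inner
begin

lift_definition zero_l2 :: "('a, 'b) l2" is "\<lambda>_. 0"
  by (simp add: l2_eq_def sq_integrable_zero)

lift_definition plus_l2 :: "('a, 'b) l2 \<Rightarrow> ('a, 'b) l2 \<Rightarrow> ('a, 'b) l2" is "\<lambda>f g x. f x + g x"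
  by (auto simp: l2_eq_def sq_integrable_add elim!: AE_mp)

lift_definition scaleR_l2 :: "real \<Rightarrow> ('a, 'b) l2 \<Rightarrow> ('a, 'b) l2" is "\<lambda>c f x. c *\<^sub>R f x"
  by (auto simp: l2_eq_def sq_integrable_scaleR elim!: AE_mp)

lift_definition inner_l2 :: "('a, 'b) l2 \<Rightarrow> ('a, 'b) l2 \<Rightarrow> real"
  is "\<lambda>f g. \<integral>x. f x \<bullet> g x \<partial>lborel"
  unfolding l2_eq_def
  by (intro integral_cong_AE borel_measurable_inner) (auto simp: sq_integrable_def elim!: AE_mp)

definition uminus_l2 :: "('a, 'b) l2 \<Rightarrow> ('a, 'b) l2" where "uminus_l2 f = (-1) *\<^sub>R f"
definition minus_l2 :: "('a, 'b) l2 \<Rightarrow> ('a, 'b) l2 \<Rightarrow> ('a, 'b) l2" where "minus_l2 f g = f + - g"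
definition norm_l2 :: "('a, 'b) l2 \<Rightarrow> real" where "norm_l2 f = sqrt (f \<bullet> f)"
definition dist_l2 :: "('a, 'b) l2 \<Rightarrow> ('a, 'b) l2 \<Rightarrow> real" where "dist_l2 f g = norm (f - g)"
definition sgn_l2 :: "('a, 'b) l2 \<Rightarrow> ('a, 'b) l2" where "sgn_l2 f = inverse (norm f) *\<^sub>R f"
definition uniformity_l2 :: "(('a, 'b) l2 \<times> ('a, 'b) l2) filter" where
  "uniformity_l2 = (INF e\<in>{0<..}. principal {(f, g). dist f g < e})"
definition open_l2 :: "('a, 'b) l2 set \<Rightarrow> bool" where
  "open_l2 U \<longleftrightarrow> (\<forall>f\<in>U. eventually (\<lambda>(f', g). f' = f \<longrightarrow> g \<in> U) uniformity)"

instance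
proof
  fix f g h :: "('a, 'b) l2" and a b :: real and U :: "('a, 'b) l2 set"
  show "f + g + h = f + (g + h)"
    by transfer (auto simp: l2_eq_def sq_integrable_add algebra_simps)
  show "f + g = g + f"
    by transfer (auto simp: l2_eq_def sq_integrable_add algebra_simps)
  show "0 + f = f" by transfer (auto simp: l2_eq_def)
  show "- f + f = 0" unfolding uminus_l2_def
    by transfer (auto simp: l2_eq_def sq_integrable_add sq_integrable_zero)
  show "f - g = f + - g" by (rule minus_l2_def)
  show "a *\<^sub>R (f + g) = a *\<^sub>R f + a *\<^sub>R g"
    by transfer (auto simp: l2_eq_def algebra_simps intro!: sq_integrable_add sq_integrable_scaleR)
  show "(a + b) *\<^sub>R f = a *\<^sub>R f + b *\<^sub>R f"
    by transfer (auto simp: l2_eq_def algebra_simps intro!: sq_integrable_add sq_integrable_scaleR)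
  show "a *\<^sub>R b *\<^sub>R f = (a * b) *\<^sub>R f"
    by transfer (auto simp: l2_eq_def intro!: sq_integrable_scaleR)
  show "1 *\<^sub>R f = f" by transfer (auto simp: l2_eq_def)
  show "dist f g = norm (f - g)" by (rule dist_l2_def)
  show "sgn f = inverse (norm f) *\<^sub>R f" by (rule sgn_l2_def)
  show "uniformity = (INF e\<in>{0<..}. principal {(f::('a, 'b) l2, g). dist f g < e})"
    by (rule uniformity_l2_def)
  show "open U \<longleftrightarrow> (\<forall>f\<in>U. eventually (\<lambda>(f', g). f' = f \<longrightarrow> g \<in> U) uniformity)"
    by (rule open_l2_def)
  show "f \<bullet> g = g \<bullet> f" by transfer (simp add: inner_commute)
  show "(f + g) \<bullet> h = f \<bullet> h + g \<bullet> h"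
    by transfer (auto simp: l2_eq_def inner_add_left sq_integrable_inner)
  show "(a *\<^sub>R f) \<bullet> g = a * (f \<bullet> g)" by transfer simp
  show "0 \<le> f \<bullet> f" by transfer simp
  show "f \<bullet> f = 0 \<longleftrightarrow> f = 0"
  proof transfer
    fix f :: "'a \<Rightarrow> 'b" assume "l2_eq f f"
    then have f: "sq_integrable f" by (simp add: l2_eq_def)
    have "(\<integral>x. f x \<bullet> f x \<partial>lborel) = 0 \<longleftrightarrow> (AE x in lborel. f x \<bullet> f x = 0)"
      by (intro integral_nonneg_eq_0_iff_AE sq_integrable_inner f) auto
    then show "(\<integral>x. f x \<bullet> f x \<partial>lborel) = 0 \<longleftrightarrow> l2_eq f (\<lambda>_. 0)"
      using f by (simp add: l2_eq_def sq_integrable_zero)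
  qed
  show "norm f = sqrt (f \<bullet> f)" by (rule norm_l2_def)
qed

end

text \<open>
  $L^2(\Omega)$ is identified, isometrically, with the functions on the whole space that vanish
  outside $\Omega$; thus \<open>\<bullet>\<close> is the $L^2(\Omega)$ inner product on \<open>l2_on \<Omega>\<close>.
\<close>

definition l2_on :: "'a::euclidean_space set \<Rightarrow> ('a, 'b::euclidean_space) l2 set" where
  "l2_on \<Omega> = {f. AE x in lborel. x \<notin> \<Omega> \<longrightarrow> rep_l2 f x = 0}"


section \<open>Weak divergence\<close>

text \<open>\<open>Ck k\<close> is the class of $k$ times continuously differentiable functions.\<close>

primrec Ck :: "nat \<Rightarrow> (real^'n \<Rightarrow> real) \<Rightarrow> bool" where
  "Ck 0 \<phi> \<longleftrightarrow> continuous_on UNIV \<phi>"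
| "Ck (Suc k) \<phi> \<longleftrightarrow> (\<exists>G. (\<forall>x. GDERIV \<phi> x :> G x) \<and> (\<forall>i. Ck k (\<lambda>x. G x $ i)))"

definition test_fun :: "(real^'n) set \<Rightarrow> (real^'n \<Rightarrow> real) \<Rightarrow> bool" where
  "test_fun \<Omega> \<phi> \<longleftrightarrow>
     (\<forall>k. Ck k \<phi>) \<and> compact (closure {x. \<phi> x \<noteq> 0}) \<and> closure {x. \<phi> x \<noteq> 0} \<subseteq> \<Omega>"

definition is_weak_div :: "(real^'n) set \<Rightarrow> (real^'n, real^'n) l2 \<Rightarrow> (real^'n, real) l2 \<Rightarrow> bool" where
  "is_weak_div \<Omega> \<sigma> g \<longleftrightarrow> g \<in> l2_on \<Omega> \<and>
     (\<forall>\<phi> G. test_fun \<Omega> \<phi> \<longrightarrow> (\<forall>x. GDERIV \<phi> x :> G x) \<longrightarrow>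
        (LINT x:\<Omega>|lborel. rep_l2 g x * \<phi> x) = - (LINT x:\<Omega>|lborel. rep_l2 \<sigma> x \<bullet> G x))"

definition H_div :: "(real^'n) set \<Rightarrow> (real^'n, real^'n) l2 set" where
  "H_div \<Omega> = {\<sigma> \<in> l2_on \<Omega>. \<exists>g. is_weak_div \<Omega> \<sigma> g}"

definition weak_div :: "(real^'n) set \<Rightarrow> (real^'n, real^'n) l2 \<Rightarrow> (real^'n, real) l2" where
  "weak_div \<Omega> \<sigma> = (THE g. is_weak_div \<Omega> \<sigma> g)"


section \<open>Domains, triangulations and Raviart--Thomas spaces\<close>

definition bounded_polygonal_domain :: "(real^'n) set \<Rightarrow> bool" where
  "bounded_polygonal_domain \<Omega> \<longleftrightarrow> open \<Omega> \<and> connected \<Omega> \<and> \<Omega> \<noteq> {} \<and> bounded \<Omega> \<and>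
     (\<exists>\<F>. finite \<F> \<and> (\<forall>F\<in>\<F>. polytope F) \<and> frontier \<Omega> = \<Union>\<F>)"

definition triangulation_of :: "(real^'n) set \<Rightarrow> (real^'n) set set \<Rightarrow> bool" where
  "triangulation_of \<Omega> \<T> \<longleftrightarrow>
     triangulation \<T> \<and> (\<forall>K\<in>\<T>. int CARD('n) simplex K) \<and> \<Union>\<T> = closure \<Omega>"

definition is_refinement :: "(real^'n) set set \<Rightarrow> (real^'n) set set \<Rightarrow> bool" where
  "is_refinement \<T>' \<T> \<longleftrightarrow> (\<forall>K'\<in>\<T>'. \<exists>K\<in>\<T>. K' \<subseteq> K)"

definition shape_regular :: "real \<Rightarrow> (real^'n) set set \<Rightarrow> bool" where
  "shape_regular \<kappa> \<T> \<longleftrightarrow>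
     (\<forall>K\<in>\<T>. diameter K \<le> \<kappa> * Sup {diameter (cball x \<rho>) | x \<rho>. cball x \<rho> \<subseteq> K})"

definition mesh_size :: "(real^'n) set set \<Rightarrow> real" where
  "mesh_size \<T> = Max (diameter ` \<T>)"

text \<open>Polynomial functions of total degree at most \<open>r\<close>; \<open>\<alpha>\<close> ranges over multi-indices.\<close>

definition polys :: "nat \<Rightarrow> (real^'n \<Rightarrow> real) set" where
  "polys r = {p. \<exists>c. p = (\<lambda>x. \<Sum>\<alpha> | (\<Sum>i\<in>UNIV. \<alpha> i) \<le> r. c \<alpha> * (\<Prod>i\<in>UNIV. (x $ i) ^ \<alpha> i))}"

text \<open>
  The shape functions are $P_r^n + x P_r$, which equals $P_r^n \oplus x \tilde P_r$ with
  $\tilde P_r$ the homogeneous polynomials of degree $r$; the lowest order space has index 0.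
\<close>

definition RT_shape :: "nat \<Rightarrow> (real^'n \<Rightarrow> real^'n) set" where
  "RT_shape r = {v. \<exists>p q. (\<forall>i. (\<lambda>x. p x $ i) \<in> polys r) \<and> q \<in> polys r \<and>
                      v = (\<lambda>x. p x + q x *\<^sub>R x)}"

definition RT_space ::
    "(real^'n) set \<Rightarrow> nat \<Rightarrow> (real^'n) set set \<Rightarrow> (real^'n, real^'n) l2 set" where
  "RT_space \<Omega> r \<T> =
     {\<tau> \<in> H_div \<Omega>. \<forall>K\<in>\<T>. \<exists>v\<in>RT_shape r. AE x in lborel. x \<in> K \<longrightarrow> rep_l2 \<tau> x = v x}"


section \<open>Operators on finite-dimensional subspaces\<close>

text \<open>
  An operator on a subspace \<open>V\<close> is a function on the ambient space of which only the values
  on \<open>V\<close> matter.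
\<close>

definition sym_pos_def_on :: "'a::real_inner set \<Rightarrow> ('a \<Rightarrow> 'a) \<Rightarrow> bool" where
  "sym_pos_def_on V A \<longleftrightarrow>
     (\<forall>x\<in>V. A x \<in> V) \<and>
     (\<forall>x\<in>V. \<forall>y\<in>V. A (x + y) = A x + A y) \<and>
     (\<forall>c. \<forall>x\<in>V. A (c *\<^sub>R x) = c *\<^sub>R A x) \<and>
     (\<forall>x\<in>V. \<forall>y\<in>V. A x \<bullet> y = x \<bullet> A y) \<and>
     (\<forall>x\<in>V. x \<noteq> 0 \<longrightarrow> 0 < A x \<bullet> x)"

definition oproj :: "'a::real_inner set \<Rightarrow> 'a \<Rightarrow> 'a" where
  "oproj W x = (THE p. p \<in> W \<and> (\<forall>w\<in>W. p \<bullet> w = x \<bullet> w))"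

definition eigenspace :: "'a::real_vector set \<Rightarrow> ('a \<Rightarrow> 'a) \<Rightarrow> real \<Rightarrow> 'a set" where
  "eigenspace V A \<mu> = {v\<in>V. A v = \<mu> *\<^sub>R v}"

definition spectrum :: "'a::real_vector set \<Rightarrow> ('a \<Rightarrow> 'a) \<Rightarrow> real set" where
  "spectrum V A = {\<mu>. \<exists>v\<in>V. v \<noteq> 0 \<and> A v = \<mu> *\<^sub>R v}"

text \<open>Fractional powers of a symmetric positive definite operator, by spectral decomposition.\<close>

definition frac_power :: "'a::real_inner set \<Rightarrow> ('a \<Rightarrow> 'a) \<Rightarrow> real \<Rightarrow> 'a \<Rightarrow> 'a" where
  "frac_power V A \<theta> x = (\<Sum>\<mu>\<in>spectrum V A. (\<mu> powr \<theta>) *\<^sub>R oproj (eigenspace V A \<mu>) x)"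

definition Lam :: "(real^'n) set \<Rightarrow> (real^'n, real^'n) l2 set
    \<Rightarrow> (real^'n, real^'n) l2 \<Rightarrow> (real^'n, real^'n) l2" where
  "Lam \<Omega> V \<sigma> =
     (THE \<rho>. \<rho> \<in> V \<and> (\<forall>\<tau>\<in>V. \<rho> \<bullet> \<tau> = \<sigma> \<bullet> \<tau> + weak_div \<Omega> \<sigma> \<bullet> weak_div \<Omega> \<tau>))"

definition Lam_pow :: "(real^'n) set \<Rightarrow> (real^'n, real^'n) l2 set \<Rightarrow> real
    \<Rightarrow> (real^'n, real^'n) l2 \<Rightarrow> (real^'n, real^'n) l2" where
  "Lam_pow \<Omega> V \<theta> = frac_power V (Lam \<Omega> V) \<theta>"

text \<open>\<open>P_op \<Omega> V s k\<close> is $P^s_{k,k-1}$ for the sequence of spaces \<open>V 1, V 2, \<dots>\<close>.\<close>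

definition P_op :: "(real^'n) set \<Rightarrow> (nat \<Rightarrow> (real^'n, real^'n) l2 set) \<Rightarrow> real \<Rightarrow> nat
    \<Rightarrow> (real^'n, real^'n) l2 \<Rightarrow> (real^'n, real^'n) l2" where
  "P_op \<Omega> V s k \<sigma> =
     (if k \<le> 1 then 0
      else (THE \<rho>. \<rho> \<in> V (k - 1) \<and>
             (\<forall>\<tau>\<in>V (k - 1). Lam_pow \<Omega> (V (k - 1)) s \<rho> \<bullet> \<tau> = Lam_pow \<Omega> (V k) s \<sigma> \<bullet> \<tau>)))"

definition B_op :: "(nat \<Rightarrow> 'a::real_inner set) \<Rightarrow> (nat \<Rightarrow> 'a \<Rightarrow> 'a) \<Rightarrow> nat \<Rightarrow> 'a \<Rightarrow> 'a" where
  "B_op V R J \<tau> = (\<Sum>k=1..J. R k (oproj (V k) \<tau>))"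

end

theory Submission
  imports Defs
begin

text \<open>
  Write $f = \Lambda_h^s\tau$. Since $R_k$ maps into $V_k$, the middle term of the estimate is
  $(B f, f) = \sum_k (R_k Q_k f, Q_k f)$, so both bounds follow once the forms
  $(\Lambda_k^s\cdot,\cdot)$ of different levels are compared with each other.

  The comparison is $(\Lambda_k^s\sigma,\sigma) \le (\Lambda_{k-1}^s\sigma,\sigma)$ for
  $\sigma \in V_{k-1}$ (\<open>frac_power_compression_le\<close>). For $s = 0$ and $s = 1$ it is an equality,
  because both levels use the same bilinear form. For $0 < s < 1$ it is real interpolation: up to
  a constant, $\lambda^s$ is the integral of $t^{s-1}\lambda/(\lambda+t)$ over $t > 0$, and
  $(\Lambda_k(\Lambda_k+t)^{-1}\sigma,\sigma)$ is the minimum of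
  $t^{-1}(\Lambda_k v,v) + \|\sigma-v\|^2$ over $v \in V_k$. The minimum over the smaller space
  $V_{k-1}$ is larger, for every $t$, and integrating over $t$ preserves this.

  Upper bound (\<open>B_op_upper_bound\<close>): the hypothesis on $R_k$ bounds each summand by
  $C_1(\Lambda_k^{-s}Q_kf,Q_kf)$. With $u = \Lambda_k^{-s}Q_kf$, one has
  $(\Lambda_k^{-s}Q_kf,Q_kf) = (u,Q_kf) = (u,\Lambda_h^s\tau)$, and the Cauchy-Schwarz inequality for $\Lambda_h^s$ together
  with $(\Lambda_h^su,u) \le (\Lambda_k^su,u)$ shows that
  $(\Lambda_k^{-s}Q_kf,Q_kf) \le (\Lambda_h^s\tau,\tau)$. There are $J$ summands.

  Lower bound (\<open>B_op_lower_bound\<close>): applying the $P^s_{k,k-1}$ one after the other from the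
  finest level down decomposes $\tau$ as $\sum_k v_k$ with $v_k$ in the range of
  $I-P^s_{k,k-1}$, and by the comparison of levels the sum of the energies
  $(\Lambda_k^sv_k,v_k)$ telescopes to at most $(\Lambda_h^s\tau,\tau)$. Then
  $(\Lambda_h^s\tau,\tau) = \sum_k(Q_kf,v_k)$, and each term is estimated by Young's inequality in
  the form of $R_k$, which leaves $(Bf,f)$ and $\sum_k(R_k^{-1}v_k,v_k)$.

  What remains is that the operators are what they are meant to be. The spaces $V_k$ are
  finite-dimensional because their members are given on each of finitely many simplices by a shape
  function from a finite-dimensional space. The form defining $\Lambda_k$ is bilinear because the
  weak divergence is unique, which is the fundamental lemma of the calculus of variations. The
  fractional powers, defined through spectrum and eigenspaces, become diagonal in an orthonormal
  eigenbasis.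
\<close>

section \<open>Orthonormal bases and projections\<close>

definition onb :: "'a::real_inner set \<Rightarrow> 'a set \<Rightarrow> bool" where
  "onb E V \<longleftrightarrow> finite E \<and> (\<forall>e\<in>E. \<forall>f\<in>E. e \<bullet> f = (if e = f then 1 else 0)) \<and> span E = V"

definition finite_dim_subspace :: "'a::real_vector set \<Rightarrow> bool" where
  "finite_dim_subspace V \<longleftrightarrow> (\<exists>B. finite B \<and> span B = V)"

lemma onb_finite: "onb E V \<Longrightarrow> finite E"
  by (simp add: onb_def)

lemma onb_inner: "onb E V \<Longrightarrow> e \<in> E \<Longrightarrow> f \<in> E \<Longrightarrow> e \<bullet> f = (if e = f then 1 else 0)"
  by (simp add: onb_def)

lemma onb_subset: "onb E V \<Longrightarrow> E \<subseteq> V"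
  unfolding onb_def using span_superset by blast

lemma onb_subspace: "onb E V \<Longrightarrow> subspace V"
  unfolding onb_def by auto

lemma inner_orthonormal_sum:
  assumes "onb E V" "f \<in> E"
  shows "(\<Sum>e\<in>E. c e *\<^sub>R e) \<bullet> f = c f"
proof -
  have "(\<Sum>e\<in>E. c e *\<^sub>R e) \<bullet> f = (\<Sum>e\<in>E. if e = f then c e else 0)"
    unfolding inner_sum_left by (rule sum.cong) (use assms in \<open>auto simp: onb_inner\<close>)
  also have "\<dots> = c f"
    by (subst sum.delta) (use assms in \<open>auto simp: onb_finite\<close>)
  finally show ?thesis .
qed

lemma onb_expand:
  assumes E: "onb E V" and x: "x \<in> V"
  shows "(\<Sum>e\<in>E. (x \<bullet> e) *\<^sub>R e) = x"
proof -
  obtain u where u: "x = (\<Sum>e\<in>E. u e *\<^sub>R e)"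
    using E x span_finite[of E] by (auto simp: onb_def)
  have "x \<bullet> e = u e" if "e \<in> E" for e
    unfolding u by (rule inner_orthonormal_sum[OF E that])
  then show ?thesis
    using u by simp
qed

lemma onb_sum_mem: "onb E V \<Longrightarrow> (\<Sum>e\<in>E. c e *\<^sub>R e) \<in> V"
  by (intro subspace_sum subspace_scale onb_subspace) (use onb_subset in auto)

lemma onb_inner_sums:
  assumes "onb E V"
  shows "(\<Sum>e\<in>E. c e *\<^sub>R e) \<bullet> (\<Sum>e\<in>E. d e *\<^sub>R e) = (\<Sum>e\<in>E. c e * d e)"
proof -
  have "(\<Sum>e\<in>E. c e *\<^sub>R e) \<bullet> (\<Sum>e\<in>E. d e *\<^sub>R e) = (\<Sum>f\<in>E. d f * ((\<Sum>e\<in>E. c e *\<^sub>R e) \<bullet> f))"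
    by (simp add: inner_sum_right)
  also have "\<dots> = (\<Sum>e\<in>E. c e * d e)"
    by (rule sum.cong) (use inner_orthonormal_sum[OF assms] in \<open>auto simp: mult.commute\<close>)
  finally show ?thesis .
qed

lemma onb_ext:
  assumes E: "onb E V" and x: "x \<in> V" "y \<in> V" and eq: "\<And>e. e \<in> E \<Longrightarrow> x \<bullet> e = y \<bullet> e"
  shows "x = y"
proof -
  have "(\<Sum>e\<in>E. (x \<bullet> e) *\<^sub>R e) = (\<Sum>e\<in>E. (y \<bullet> e) *\<^sub>R e)"
    using eq by simp
  then show ?thesis
    using onb_expand[OF E] x by simp
qed

lemma inner_ext:
  assumes "subspace V" "x \<in> V" "y \<in> V" and eq: "\<And>v. v \<in> V \<Longrightarrow> x \<bullet> v = y \<bullet> v"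
  shows "x = y"
proof -
  have "x - y \<in> V" using assms by (simp add: subspace_diff)
  then have "(x - y) \<bullet> (x - y) = 0" using eq[of "x - y"] by (simp add: inner_diff_left)
  then show ?thesis by simp
qed

lemma finite_dim_subspace_onb:
  fixes V :: "'a::real_inner set"
  assumes "finite_dim_subspace V"
  obtains E where "onb E V"
proof -
  obtain B where B: "finite B" "span B = V"
    using assms by (auto simp: finite_dim_subspace_def)
  obtain C where C: "finite C" "span C = V" "pairwise orthogonal C"
    using basis_orthogonal[OF B(1)] B(2) by auto
  define E where "E = (\<lambda>x. x /\<^sub>R norm x) ` (C - {0})"
  have "span E = span (C - {0})"
    unfolding E_def by (rule span_image_scale) (use C in auto)
  then have "span E = V"
    using C by (simp add: span_delete_0)
  moreover have "e \<bullet> f = (if e = f then 1 else 0)" if ef: "e \<in> E" "f \<in> E" for e f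
  proof -
    obtain x y where xy: "x \<in> C" "x \<noteq> 0" "e = x /\<^sub>R norm x" "y \<in> C" "y \<noteq> 0" "f = y /\<^sub>R norm y"
      using ef by (auto simp: E_def)
    have one: "e \<bullet> e = 1"
      using xy by (simp add: dot_square_norm power2_eq_square)
    have zero: "e \<bullet> f = 0" if "x \<noteq> y"
      using C(3) xy that by (auto simp: pairwise_def orthogonal_def)
    show ?thesis
    proof (cases "x = y")
      case True
      then show ?thesis using one xy by simp
    next
      case False
      then have "e \<noteq> f" using one zero by auto
      then show ?thesis using zero[OF False] by simp
    qed
  qed
  ultimately show ?thesis
    using that[of E] C(1) by (auto simp: onb_def E_def)
qed

lemma finite_dim_subspaceI:
  assumes "subspace V" "finite B" "V \<subseteq> span B"
  shows "finite_dim_subspace V"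
proof -
  obtain C where C: "C \<subseteq> V" "independent C" "V \<subseteq> span C"
    using maximal_independent_subset by blast
  have "finite C"
    using independent_span_bound[OF assms(2) C(2)] C(1) assms(3) by auto
  moreover have "span C = V"
    using C assms(1) by (metis span_mono span_eq_iff subset_antisym)
  ultimately show ?thesis
    by (auto simp: finite_dim_subspace_def)
qed

lemma onb_inner_expand:
  assumes E: "onb E V" and y: "y \<in> V"
  shows "x \<bullet> y = (\<Sum>e\<in>E. (x \<bullet> e) * (y \<bullet> e))"
  by (subst onb_expand[OF E y, symmetric]) (simp add: inner_sum_right mult.commute)

lemma inner_onb_projection:
  assumes E: "onb E W" and w: "w \<in> W"
  shows "(\<Sum>e\<in>E. (x \<bullet> e) *\<^sub>R e) \<bullet> w = x \<bullet> w"
  unfolding onb_inner_expand[OF E w]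
  by (intro sum.cong refl) (simp only: inner_orthonormal_sum[OF E])

lemma oproj_onb:
  assumes "onb E W"
  shows "oproj W x = (\<Sum>e\<in>E. (x \<bullet> e) *\<^sub>R e)"
  unfolding oproj_def
proof (rule the_equality)
  let ?p = "\<Sum>e\<in>E. (x \<bullet> e) *\<^sub>R e"
  show *: "?p \<in> W \<and> (\<forall>w\<in>W. ?p \<bullet> w = x \<bullet> w)"
    using onb_sum_mem[OF assms] inner_onb_projection[OF assms] by blast
  show "p = ?p" if "p \<in> W \<and> (\<forall>w\<in>W. p \<bullet> w = x \<bullet> w)" for p
    using * that by (intro inner_ext[OF onb_subspace[OF assms]]) auto
qed

lemma oproj_mem:
  assumes "onb E W"
  shows "oproj W x \<in> W"
  using oproj_onb[OF assms] onb_sum_mem[OF assms] by simp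

lemma inner_oproj:
  assumes "onb E W" "w \<in> W"
  shows "oproj W x \<bullet> w = x \<bullet> w"
  unfolding oproj_onb[OF assms(1)] by (rule inner_onb_projection[OF assms])

text \<open>
  By induction on the basis: a vector of the unit ball splits into a multiple of the new basis
  vector and a part in the old span, both of norm at most one, so the ball is a closed part of a
  continuous image of a product of compact sets.
\<close>

lemma compact_unit_ball_span_orthonormal:
  fixes E :: "'a::real_inner set"
  assumes "finite E" "\<forall>e\<in>E. \<forall>f\<in>E. e \<bullet> f = (if e = f then 1 else 0)"
  shows "compact (span E \<inter> cball 0 1)"
  using assms
proof (induction E rule: finite_induct)
  case empty
  then show ?case by simp
next
  case (insert e E)
  let ?K = "span E \<inter> cball (0::'a) 1"
  let ?I = "(\<lambda>p. fst p *\<^sub>R e + snd p) ` ({-1..1::real} \<times> ?K)"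
  have "compact ?K"
    using insert by simp
  then have "compact ?I"
    by (intro compact_continuous_image compact_Times continuous_intros) auto
  moreover have "span (insert e E) \<inter> cball 0 1 = ?I \<inter> cball 0 1"
  proof (intro equalityI subsetI)
    fix y assume y: "y \<in> span (insert e E) \<inter> cball 0 1"
    then obtain k where k: "y - k *\<^sub>R e \<in> span E"
      by (auto simp: span_breakdown_eq)
    define x where "x = y - k *\<^sub>R e"
    have ee: "e \<bullet> e = 1" using insert by auto
    have "orthogonal e x"
      by (rule orthogonal_to_span) (use insert k in \<open>auto simp: x_def orthogonal_def\<close>)
    then have xe: "e \<bullet> x = 0" "x \<bullet> e = 0" by (auto simp: orthogonal_def inner_commute)
    have "y \<bullet> y = k\<^sup>2 + x \<bullet> x"
    proof -
      have "y = k *\<^sub>R e + x" by (simp add: x_def)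
      then show ?thesis
        using xe ee by (simp add: inner_add_left inner_add_right power2_eq_square)
    qed
    moreover have "y \<bullet> y \<le> 1"
      using y by (simp add: norm_le_square)
    ultimately have "k\<^sup>2 \<le> 1" "x \<bullet> x \<le> 1"
      using inner_ge_zero[of x] zero_le_power2[of k] by linarith+
    then have "\<bar>k\<bar> \<le> 1" "norm x \<le> 1"
      by (auto simp: abs_square_le_1 norm_le_square)
    then have "(k, x) \<in> {-1..1} \<times> ?K" "y = fst (k, x) *\<^sub>R e + snd (k, x)"
      using k by (auto simp: x_def)
    then have "y \<in> ?I"
      by (rule rev_image_eqI)
    then show "y \<in> ?I \<inter> cball 0 1"
      using y by blast
  next
    fix y assume "y \<in> ?I \<inter> cball 0 1"
    then show "y \<in> span (insert e E) \<inter> cball 0 1"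
      using span_mono[OF subset_insertI, of E e]
      by (auto intro!: span_add span_scale[OF span_base])
  qed
  ultimately show ?case
    by (simp add: compact_Int_closed)
qed

lemma compact_unit_ball_onb: "onb E V \<Longrightarrow> compact (V \<inter> cball 0 1)"
  using compact_unit_ball_span_orthonormal[of E] by (auto simp: onb_def)

section \<open>Symmetric positive definite operators\<close>

lemma sym_pos_def_on_mem: "sym_pos_def_on V A \<Longrightarrow> x \<in> V \<Longrightarrow> A x \<in> V"
  by (simp add: sym_pos_def_on_def)

lemma sym_pos_def_on_add: "sym_pos_def_on V A \<Longrightarrow> x \<in> V \<Longrightarrow> y \<in> V \<Longrightarrow> A (x + y) = A x + A y"
  by (simp add: sym_pos_def_on_def)

lemma sym_pos_def_on_scale: "sym_pos_def_on V A \<Longrightarrow> x \<in> V \<Longrightarrow> A (c *\<^sub>R x) = c *\<^sub>R A x"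
  by (simp add: sym_pos_def_on_def)

lemma sym_pos_def_on_sym: "sym_pos_def_on V A \<Longrightarrow> x \<in> V \<Longrightarrow> y \<in> V \<Longrightarrow> A x \<bullet> y = x \<bullet> A y"
  by (simp add: sym_pos_def_on_def)

lemma sym_pos_def_on_pos:
  assumes "sym_pos_def_on V A" "x \<in> V" "x \<noteq> 0"
  shows "0 < A x \<bullet> x"
proof -
  have "\<forall>x\<in>V. x \<noteq> 0 \<longrightarrow> 0 < A x \<bullet> x"
    using assms(1) unfolding sym_pos_def_on_def by (elim conjE)
  then show ?thesis
    using assms(2,3) by blast
qed

lemma sym_pos_def_on_sum:
  assumes A: "sym_pos_def_on V A" and V: "subspace V" and "finite I" "\<And>i. i \<in> I \<Longrightarrow> v i \<in> V"
  shows "A (\<Sum>i\<in>I. c i *\<^sub>R v i) = (\<Sum>i\<in>I. c i *\<^sub>R A (v i))"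
  using assms(3,4)
proof (induction I rule: finite_induct)
  case empty
  show ?case
    using sym_pos_def_on_scale[OF A subspace_0[OF V], of 0] by simp
next
  case (insert i I)
  have "(\<Sum>i\<in>I. c i *\<^sub>R v i) \<in> V" "v i \<in> V" "c i *\<^sub>R v i \<in> V"
    using V insert by (auto intro!: subspace_sum subspace_scale)
  then show ?case
    using insert by (simp add: sym_pos_def_on_add[OF A] sym_pos_def_on_scale[OF A])
qed

lemma sym_pos_def_on_inner_nonneg:
  assumes "sym_pos_def_on V A" "subspace V" "x \<in> V"
  shows "0 \<le> A x \<bullet> x"
proof (cases "x = 0")
  case False
  then show ?thesis
    using sym_pos_def_on_pos[OF assms(1,3)] by simp
qed simp

lemma sym_pos_def_on_diff:
  assumes "sym_pos_def_on V A" "subspace V" "x \<in> V" "y \<in> V"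
  shows "A (x - y) = A x - A y"
  using sym_pos_def_on_add[OF assms(1,3), of "(-1) *\<^sub>R y"] sym_pos_def_on_scale[OF assms(1,4), of "-1"]
    subspace_neg[OF assms(2,4)] by simp

text \<open>
  For \<open>c = 0\<close> the polynomial is affine in \<open>t\<close>, so its slope has to vanish; this
  degenerate case is used below to show that a maximizer of a Rayleigh quotient is an eigenvector.
\<close>

lemma nonneg_quadratic_discriminant:
  fixes a b c :: real
  assumes "\<And>t. 0 \<le> a + 2 * t * b + t\<^sup>2 * c" "0 \<le> c"
  shows "b\<^sup>2 \<le> a * c"
proof (cases "c = 0")
  case True
  have "b = 0"
  proof (rule ccontr)
    assume "b \<noteq> 0"
    then show False
      using assms(1)[of "- (a + 1) / (2 * b)"] True by (simp add: field_simps)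
  qed
  then show ?thesis using True by simp
next
  case False
  then have c: "0 < c" using assms(2) by simp
  have "0 \<le> a + 2 * (- b / c) * b + (- b / c)\<^sup>2 * c" by (rule assms(1))
  also have "\<dots> = a - b\<^sup>2 / c" using c by (simp add: power2_eq_square field_simps)
  finally show ?thesis using c by (simp add: field_simps)
qed

lemma sym_pos_def_on_Cauchy_Schwarz:
  assumes A: "sym_pos_def_on V A" and V: "subspace V" and x: "x \<in> V" and y: "y \<in> V"
  shows "(A x \<bullet> y)\<^sup>2 \<le> (A x \<bullet> x) * (A y \<bullet> y)"
proof (rule nonneg_quadratic_discriminant)
  fix t :: real
  have ty: "t *\<^sub>R y \<in> V" using V y by (simp add: subspace_scale)
  have "0 \<le> A (x + t *\<^sub>R y) \<bullet> (x + t *\<^sub>R y)"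
    by (rule sym_pos_def_on_inner_nonneg[OF A V]) (use V x ty in \<open>simp add: subspace_add\<close>)
  also have "\<dots> = A x \<bullet> x + 2 * t * (A x \<bullet> y) + t\<^sup>2 * (A y \<bullet> y)"
    using sym_pos_def_on_sym[OF A y x]
    by (simp add: sym_pos_def_on_add[OF A x ty] sym_pos_def_on_scale[OF A y] inner_add_left
        inner_add_right power2_eq_square algebra_simps inner_commute[of y])
  finally show "0 \<le> A x \<bullet> x + 2 * t * (A x \<bullet> y) + t\<^sup>2 * (A y \<bullet> y)" .
qed (rule sym_pos_def_on_inner_nonneg[OF A V y])

section \<open>The spectral theorem and fractional powers\<close>

text \<open>
  A maximizer \<open>w\<close> of the Rayleigh quotient over the unit sphere of \<open>W\<close>, with maximum \<open>\<mu>\<close>,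
  makes the form $\mu(x,y)-(Ax,y)$ positive semidefinite on \<open>W\<close> and isotropic at \<open>w\<close>; hence
  \<open>w\<close> is orthogonal to all of \<open>W\<close> in this form, which says $Aw = \mu w$. The space \<open>W\<close> is
  the part of \<open>V\<close> orthogonal to the eigenvectors \<open>F\<close> already found.
\<close>

lemma sym_pos_def_on_eigenvector:
  assumes A: "sym_pos_def_on V A" and E: "onb E V"
    and W: "W = {x\<in>V. \<forall>f\<in>F. x \<bullet> f = 0}" "W \<noteq> {0}" and inv: "\<And>x. x \<in> W \<Longrightarrow> A x \<in> W"
  obtains w where "w \<in> W" "w \<bullet> w = 1" "(A w \<bullet> w) *\<^sub>R w = A w"
proof -
  have V: "subspace V" by (rule onb_subspace[OF E])
  have subW: "subspace W"
    using V unfolding W(1) subspace_def by (auto simp: inner_add_left)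
  have WV: "W \<subseteq> V" using W(1) by auto
  let ?S = "W \<inter> sphere 0 1"
  have "closed {x. x \<bullet> f = 0}" for f :: 'a
    by (intro closed_Collect_eq continuous_intros)
  moreover have "closed (sphere (0::'a) 1)"
    unfolding sphere_def dist_0_norm by (intro closed_Collect_eq continuous_intros)
  ultimately have "closed ((\<Inter>f\<in>F. {x. x \<bullet> f = 0}) \<inter> sphere 0 1)"
    by (intro closed_Int closed_INT ballI)
  then have "compact ((V \<inter> cball 0 1) \<inter> ((\<Inter>f\<in>F. {x. x \<bullet> f = 0}) \<inter> sphere 0 1))"
    by (rule compact_Int_closed[OF compact_unit_ball_onb[OF E]])
  moreover have "(V \<inter> cball 0 1) \<inter> ((\<Inter>f\<in>F. {x. x \<bullet> f = 0}) \<inter> sphere 0 1) = ?S"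
    unfolding W(1) by auto
  ultimately have "compact ?S" by simp
  moreover have "?S \<noteq> {}"
  proof -
    obtain x where "x \<in> W" "x \<noteq> 0"
      using W(2) subspace_0[OF subW] by auto
    then have "x /\<^sub>R norm x \<in> ?S"
      using subW by (auto simp: subspace_scale)
    then show ?thesis by blast
  qed
  moreover have "continuous_on ?S (\<lambda>x. A x \<bullet> x)"
  proof -
    have "A x = (\<Sum>e\<in>E. (x \<bullet> e) *\<^sub>R A e)" if "x \<in> V" for x
      using sym_pos_def_on_sum[OF A V onb_finite[OF E], of "\<lambda>e. e" "\<lambda>e. x \<bullet> e"]
        onb_expand[OF E that] onb_subset[OF E] by auto
    then have "continuous_on ?S (\<lambda>x. A x \<bullet> x) = continuous_on ?S (\<lambda>x. (\<Sum>e\<in>E. (x \<bullet> e) *\<^sub>R A e) \<bullet> x)"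
      using WV by (intro continuous_on_cong) auto
    then show ?thesis
      by (simp add: continuous_intros)
  qed
  ultimately obtain w where w: "w \<in> ?S" and max: "\<And>y. y \<in> ?S \<Longrightarrow> A y \<bullet> y \<le> A w \<bullet> w"
    using continuous_attains_sup[of ?S "\<lambda>x. A x \<bullet> x"] by blast
  define \<mu> where "\<mu> = A w \<bullet> w"
  have wW: "w \<in> W" and wV: "w \<in> V" and ww: "w \<bullet> w = 1"
    using w WV by (auto simp: norm_eq_1)
  have bound: "A x \<bullet> x \<le> \<mu> * (x \<bullet> x)" if x: "x \<in> W" for x
  proof (cases "x = 0")
    case True
    then show ?thesis by simp
  next
    case False
    define c where "c = inverse (norm x)"
    have "c *\<^sub>R x \<in> ?S"
      using x False subW by (auto simp: c_def subspace_scale)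
    then have "A (c *\<^sub>R x) \<bullet> (c *\<^sub>R x) \<le> \<mu>"
      using max unfolding \<mu>_def by blast
    then have "c\<^sup>2 * (A x \<bullet> x) \<le> \<mu>"
      using sym_pos_def_on_scale[OF A, of x c] x WV by (auto simp: power2_eq_square mult.assoc)
    then show ?thesis
      using False by (simp add: c_def field_simps dot_square_norm)
  qed
  have orth: "(\<mu> *\<^sub>R w - A w) \<bullet> y = 0" if y: "y \<in> W" for y
  proof -
    have yV: "y \<in> V" using y WV by auto
    \<comment> \<open>the constant coefficient of the polynomial in \<open>t\<close> is zero because \<open>w\<close> attains the maximum\<close>
    have "((\<mu> *\<^sub>R w - A w) \<bullet> y)\<^sup>2 \<le> 0 * (\<mu> * (y \<bullet> y) - A y \<bullet> y)"
    proof (rule nonneg_quadratic_discriminant)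
      fix t :: real
      have ty: "t *\<^sub>R y \<in> V" using V yV by (simp add: subspace_scale)
      have "w + t *\<^sub>R y \<in> W" using subW wW y by (simp add: subspace_add subspace_scale)
      then have "0 \<le> \<mu> * ((w + t *\<^sub>R y) \<bullet> (w + t *\<^sub>R y)) - A (w + t *\<^sub>R y) \<bullet> (w + t *\<^sub>R y)"
        using bound by simp
      also have "\<dots> = 0 + 2 * t * ((\<mu> *\<^sub>R w - A w) \<bullet> y) + t\<^sup>2 * (\<mu> * (y \<bullet> y) - A y \<bullet> y)"
        using sym_pos_def_on_sym[OF A yV wV] ww \<mu>_def[symmetric]
        by (simp add: sym_pos_def_on_add[OF A wV ty] sym_pos_def_on_scale[OF A yV] inner_add_left
            inner_add_right inner_diff_left power2_eq_square algebra_simps inner_commute[of y w]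
            inner_commute[of y "A w"])
      finally show "0 \<le> 0 + 2 * t * ((\<mu> *\<^sub>R w - A w) \<bullet> y) + t\<^sup>2 * (\<mu> * (y \<bullet> y) - A y \<bullet> y)" .
    qed (use bound[OF y] in simp)
    then show ?thesis by simp
  qed
  have "\<mu> *\<^sub>R w - A w \<in> W"
    using subW wW inv by (simp add: subspace_diff subspace_scale)
  then have "\<mu> *\<^sub>R w - A w = 0"
    using orth inner_eq_zero_iff by blast
  then have "(A w \<bullet> w) *\<^sub>R w = A w"
    by (simp add: \<mu>_def)
  then show ?thesis
    using that[OF wW ww] by blast
qed

text \<open>
  For a unit vector \<open>e\<close> the eigenvalue can only be \<open>A e \<bullet> e\<close>. The equation is oriented so
  that rewriting with it terminates.
\<close>

definition eigenbasis :: "'a::real_inner set \<Rightarrow> 'a set \<Rightarrow> ('a \<Rightarrow> 'a) \<Rightarrow> bool" where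
  "eigenbasis E V A \<longleftrightarrow> onb E V \<and> (\<forall>e\<in>E. (A e \<bullet> e) *\<^sub>R e = A e)"

text \<open>
  An orthonormal set of eigenvectors of maximal cardinality spans \<open>V\<close>: its orthogonal complement
  in \<open>V\<close> is invariant under \<open>A\<close>, so it would otherwise contain one more unit eigenvector.
\<close>

theorem eigenbasis_exists:
  assumes V: "finite_dim_subspace V" and A: "sym_pos_def_on V A"
  obtains E where "eigenbasis E V A"
proof -
  obtain B where B: "onb B V"
    using V by (rule finite_dim_subspace_onb)
  have subV: "subspace V" by (rule onb_subspace[OF B])
  define P where "P F \<longleftrightarrow> F \<subseteq> V \<and> (\<forall>e\<in>F. (A e \<bullet> e) *\<^sub>R e = A e) \<and> onb F (span F)" for F
  have "P {}"
    by (simp add: P_def onb_def)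
  moreover have "card F \<le> card B" if "P F" for F
  proof -
    have F: "e \<bullet> f = (if e = f then 1 else 0)" if "e \<in> F" "f \<in> F" for e f
      using \<open>P F\<close> that by (simp add: P_def onb_def)
    have "0 \<notin> F" using F[of 0 0] by auto
    moreover have "pairwise orthogonal F"
      using F by (auto simp: pairwise_def orthogonal_def)
    ultimately have "independent F"
      by (rule pairwise_orthogonal_independent[rotated])
    moreover have "F \<subseteq> span B"
      using that B by (simp add: P_def onb_def)
    ultimately show ?thesis
      using independent_span_bound onb_finite[OF B] by blast
  qed
  ultimately obtain F where F: "P F" and max: "\<And>G. P G \<Longrightarrow> card G \<le> card F"
    using ex_has_greatest_nat[of P "{}" card "Suc (card B)"] by (metis less_Suc_eq_le)
  have FV: "F \<subseteq> V" and eig: "\<And>e. e \<in> F \<Longrightarrow> (A e \<bullet> e) *\<^sub>R e = A e" and onF: "onb F (span F)"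
    using F by (auto simp: P_def)
  define W where "W = {x\<in>V. \<forall>f\<in>F. x \<bullet> f = 0}"
  have inv: "A x \<in> W" if "x \<in> W" for x
  proof -
    have "A x \<bullet> f = 0" if f: "f \<in> F" for f
    proof -
      have "A x \<bullet> f = x \<bullet> A f"
        using sym_pos_def_on_sym[OF A] \<open>x \<in> W\<close> f FV by (auto simp: W_def)
      also have "\<dots> = (A f \<bullet> f) * (x \<bullet> f)"
        by (subst eig[OF f, symmetric]) simp
      finally show ?thesis
        using \<open>x \<in> W\<close> f by (simp add: W_def)
    qed
    then show ?thesis
      using that sym_pos_def_on_mem[OF A] by (auto simp: W_def)
  qed
  have "W = {0}"
  proof (rule ccontr)
    assume "W \<noteq> {0}"
    then obtain w where w: "w \<in> W" "w \<bullet> w = 1" "(A w \<bullet> w) *\<^sub>R w = A w"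
      using sym_pos_def_on_eigenvector[OF A B W_def _ inv] by blast
    have "w \<notin> F" using w by (auto simp: W_def)
    moreover have "onb (insert w F) (span (insert w F))"
    proof -
      have "w \<bullet> f = 0" "f \<bullet> w = 0" if "f \<in> F" for f
        using w(1) that by (auto simp: W_def inner_commute[of f])
      then show ?thesis
        using onb_inner[OF onF] onb_finite[OF onF] w(2) \<open>w \<notin> F\<close> unfolding onb_def by auto
    qed
    moreover have "w \<in> V" using w(1) by (simp add: W_def)
    ultimately have "P (insert w F)"
      unfolding P_def using FV eig w(3) by auto
    then have "card (insert w F) \<le> card F"
      by (rule max)
    then show False
      using \<open>w \<notin> F\<close> onb_finite[OF onF] by simp
  qed
  have "V \<subseteq> span F"
  proof
    fix x assume x: "x \<in> V"
    let ?y = "\<Sum>f\<in>F. (x \<bullet> f) *\<^sub>R f"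
    have "?y \<in> V" using subV FV by (auto intro!: subspace_sum subspace_scale)
    moreover have "?y \<bullet> f = x \<bullet> f" if "f \<in> F" for f
      by (rule inner_orthonormal_sum[OF onF that])
    ultimately have "x - ?y \<in> W"
      using x subV by (simp add: W_def subspace_diff inner_diff_left)
    then have "x = ?y" using \<open>W = {0}\<close> by simp
    then show "x \<in> span F"
      using onb_sum_mem[OF onF] by metis
  qed
  then have "span F = V"
    using FV subV by (simp add: span_minimal subset_antisym)
  then show ?thesis
    using that[of F] onF eig by (simp add: eigenbasis_def)
qed

lemma eigenbasis_onb: "eigenbasis E V A \<Longrightarrow> onb E V"
  by (simp add: eigenbasis_def)

lemma eigenbasis_inner:
  assumes A: "sym_pos_def_on V A" and E: "eigenbasis E V A" and x: "x \<in> V" and e: "e \<in> E"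
  shows "A x \<bullet> e = (A e \<bullet> e) * (x \<bullet> e)"
proof -
  have "A x \<bullet> e = x \<bullet> A e"
    using sym_pos_def_on_sym[OF A x] e onb_subset[OF eigenbasis_onb[OF E]] by blast
  also have "A e = (A e \<bullet> e) *\<^sub>R e"
    using E e by (simp add: eigenbasis_def)
  finally show ?thesis by simp
qed

lemma eigenbasis_pos:
  assumes A: "sym_pos_def_on V A" and E: "eigenbasis E V A" and e: "e \<in> E"
  shows "0 < A e \<bullet> e"
proof (rule sym_pos_def_on_pos[OF A])
  show "e \<in> V" using e onb_subset[OF eigenbasis_onb[OF E]] by blast
  show "e \<noteq> 0" using onb_inner[OF eigenbasis_onb[OF E] e e] by auto
qed

lemma onb_eigenspace:
  assumes A: "sym_pos_def_on V A" and E: "eigenbasis E V A"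
  shows "onb {e\<in>E. A e \<bullet> e = \<mu>} (eigenspace V A \<mu>)"
proof -
  have onE: "onb E V" by (rule eigenbasis_onb[OF E])
  have V: "subspace V" by (rule onb_subspace[OF onE])
  let ?F = "{e\<in>E. A e \<bullet> e = \<mu>}"
  have "subspace (eigenspace V A \<mu>)"
    unfolding subspace_def eigenspace_def
    using sym_pos_def_on_add[OF A] sym_pos_def_on_scale[OF A] V
      sym_pos_def_on_scale[OF A subspace_0[OF V], of 0]
    by (auto simp: subspace_0 subspace_add subspace_scale scaleR_add_right)
  moreover have "?F \<subseteq> eigenspace V A \<mu>"
    using E onb_subset[OF onE] by (auto simp: eigenbasis_def eigenspace_def)
  ultimately have "span ?F \<subseteq> eigenspace V A \<mu>"
    by (rule span_minimal[rotated])
  moreover have "eigenspace V A \<mu> \<subseteq> span ?F"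
  proof
    fix v assume v: "v \<in> eigenspace V A \<mu>"
    then have vV: "v \<in> V" and Av: "A v = \<mu> *\<^sub>R v" by (auto simp: eigenspace_def)
    have "v \<bullet> e = 0" if "e \<in> E" "A e \<bullet> e \<noteq> \<mu>" for e
      using eigenbasis_inner[OF A E vV that(1)] Av that(2) by simp
    then have "(\<Sum>e\<in>E. (v \<bullet> e) *\<^sub>R e) = (\<Sum>e\<in>?F. (v \<bullet> e) *\<^sub>R e)"
      by (intro sum.mono_neutral_right) (auto simp: onb_finite[OF onE])
    then have "v = (\<Sum>e\<in>?F. (v \<bullet> e) *\<^sub>R e)"
      using onb_expand[OF onE vV] by simp
    then show "v \<in> span ?F"
      using span_sum[of ?F "\<lambda>e. (v \<bullet> e) *\<^sub>R e" ?F] by (metis (no_types, lifting) span_base span_scale)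
  qed
  ultimately show ?thesis
    using onE by (auto simp: onb_def)
qed

lemma spectrum_eigenbasis:
  assumes A: "sym_pos_def_on V A" and E: "eigenbasis E V A"
  shows "spectrum V A = (\<lambda>e. A e \<bullet> e) ` E"
proof (intro equalityI subsetI)
  have onE: "onb E V" by (rule eigenbasis_onb[OF E])
  show "\<mu> \<in> (\<lambda>e. A e \<bullet> e) ` E" if \<mu>: "\<mu> \<in> spectrum V A" for \<mu>
  proof -
    obtain v where v: "v \<in> V" "v \<noteq> 0" "A v = \<mu> *\<^sub>R v"
      using \<mu> by (auto simp: spectrum_def)
    then obtain e where e: "e \<in> E" "v \<bullet> e \<noteq> 0"
      using onb_ext[OF onE v(1) subspace_0[OF onb_subspace[OF onE]]] by auto
    have "A v \<bullet> e = \<mu> * (v \<bullet> e)" using v by simp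
    then have "\<mu> = A e \<bullet> e"
      using eigenbasis_inner[OF A E v(1) e(1)] e(2) by simp
    then show ?thesis using e by blast
  qed
  show "\<mu> \<in> spectrum V A" if \<mu>: "\<mu> \<in> (\<lambda>e. A e \<bullet> e) ` E" for \<mu>
  proof -
    obtain e where e: "e \<in> E" "\<mu> = A e \<bullet> e" using \<mu> by blast
    have "e \<in> V" using e onb_subset[OF onE] by blast
    moreover have "e \<noteq> 0" using onb_inner[OF onE e(1) e(1)] by auto
    moreover have "A e = \<mu> *\<^sub>R e" using E e by (auto simp: eigenbasis_def)
    ultimately show ?thesis by (auto simp: spectrum_def)
  qed
qed

text \<open>
  The eigenspace of \<open>\<mu>\<close> has the \<open>\<mu>\<close>-part of the eigenbasis as orthonormal basis, so the sum
  over the spectrum is the sum over the eigenbasis grouped by eigenvalue.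
\<close>

lemma frac_power_eigenbasis:
  assumes A: "sym_pos_def_on V A" and E: "eigenbasis E V A"
  shows "frac_power V A \<theta> x = (\<Sum>e\<in>E. ((A e \<bullet> e) powr \<theta> * (x \<bullet> e)) *\<^sub>R e)"
proof -
  let ?l = "\<lambda>e. A e \<bullet> e"
  have "frac_power V A \<theta> x = (\<Sum>\<mu>\<in>?l ` E. \<mu> powr \<theta> *\<^sub>R (\<Sum>e\<in>{e\<in>E. ?l e = \<mu>}. (x \<bullet> e) *\<^sub>R e))"
    unfolding frac_power_def spectrum_eigenbasis[OF A E] oproj_onb[OF onb_eigenspace[OF A E]] ..
  also have "\<dots> = (\<Sum>\<mu>\<in>?l ` E. \<Sum>e\<in>{e\<in>E. ?l e = \<mu>}. (?l e powr \<theta> * (x \<bullet> e)) *\<^sub>R e)"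
    by (intro sum.cong refl) (auto simp: scaleR_sum_right intro!: sum.cong)
  also have "\<dots> = (\<Sum>e\<in>E. (?l e powr \<theta> * (x \<bullet> e)) *\<^sub>R e)"
    by (rule sum.image_gen[symmetric]) (rule onb_finite[OF eigenbasis_onb[OF E]])
  finally show ?thesis .
qed

lemma inner_frac_power:
  assumes A: "sym_pos_def_on V A" and E: "eigenbasis E V A" and y: "y \<in> V"
  shows "frac_power V A \<theta> x \<bullet> y = (\<Sum>e\<in>E. (A e \<bullet> e) powr \<theta> * (x \<bullet> e) * (y \<bullet> e))"
  by (subst onb_expand[OF eigenbasis_onb[OF E] y, symmetric])
    (simp add: frac_power_eigenbasis[OF A E] onb_inner_sums[OF eigenbasis_onb[OF E]])

lemma sym_pos_def_on_frac_power:
  assumes V: "finite_dim_subspace V" and A: "sym_pos_def_on V A"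
  shows "sym_pos_def_on V (frac_power V A \<theta>)"
proof -
  obtain E where E: "eigenbasis E V A"
    by (rule eigenbasis_exists[OF V A])
  have onE: "onb E V" by (rule eigenbasis_onb[OF E])
  have "frac_power V A \<theta> x \<in> V" for x
    unfolding frac_power_eigenbasis[OF A E] by (rule onb_sum_mem[OF onE])
  moreover have "frac_power V A \<theta> (x + y) = frac_power V A \<theta> x + frac_power V A \<theta> y" for x y
    by (simp add: frac_power_eigenbasis[OF A E] inner_add_left algebra_simps sum.distrib)
  moreover have "frac_power V A \<theta> (c *\<^sub>R x) = c *\<^sub>R frac_power V A \<theta> x" for c x
    by (simp add: frac_power_eigenbasis[OF A E] scaleR_sum_right mult_ac)
  moreover have "frac_power V A \<theta> x \<bullet> y = x \<bullet> frac_power V A \<theta> y" if "x \<in> V" "y \<in> V" for x y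
    unfolding inner_commute[of x] using that by (simp add: inner_frac_power[OF A E] mult_ac)
  moreover have "0 < frac_power V A \<theta> x \<bullet> x" if x: "x \<in> V" "x \<noteq> 0" for x
  proof -
    obtain e where e: "e \<in> E" "x \<bullet> e \<noteq> 0"
      using onb_ext[OF onE x(1) subspace_0[OF onb_subspace[OF onE]]] x(2) by auto
    have "0 < (A e \<bullet> e) powr \<theta> * (x \<bullet> e) * (x \<bullet> e)"
      using eigenbasis_pos[OF A E e(1)] e(2)
      by (auto simp: mult.assoc zero_less_mult_iff linorder_neq_iff)
    then have "0 < (\<Sum>e\<in>E. (A e \<bullet> e) powr \<theta> * (x \<bullet> e) * (x \<bullet> e))"
      by (intro sum_pos2[OF onb_finite[OF onE] e(1)]) (auto simp: mult.assoc)
    then show ?thesis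
      by (simp add: inner_frac_power[OF A E x(1)])
  qed
  ultimately show ?thesis
    unfolding sym_pos_def_on_def by blast
qed

lemma frac_power_frac_power_uminus:
  assumes V: "finite_dim_subspace V" and A: "sym_pos_def_on V A" and x: "x \<in> V"
  shows "frac_power V A \<theta> (frac_power V A (- \<theta>) x) = x"
proof -
  obtain E where E: "eigenbasis E V A"
    by (rule eigenbasis_exists[OF V A])
  have onE: "onb E V" by (rule eigenbasis_onb[OF E])
  have "frac_power V A \<theta> (frac_power V A (- \<theta>) x)
      = (\<Sum>e\<in>E. ((A e \<bullet> e) powr \<theta> * ((A e \<bullet> e) powr (- \<theta>) * (x \<bullet> e))) *\<^sub>R e)"
    unfolding frac_power_eigenbasis[OF A E]
    by (intro sum.cong refl) (simp add: inner_orthonormal_sum[OF onE])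
  also have "\<dots> = (\<Sum>e\<in>E. (x \<bullet> e) *\<^sub>R e)"
  proof (intro sum.cong refl)
    fix e assume "e \<in> E"
    then have "0 < A e \<bullet> e" by (rule eigenbasis_pos[OF A E])
    then have "(A e \<bullet> e) powr \<theta> * (A e \<bullet> e) powr (- \<theta>) = 1"
      by (simp add: powr_minus)
    then show "((A e \<bullet> e) powr \<theta> * ((A e \<bullet> e) powr (- \<theta>) * (x \<bullet> e))) *\<^sub>R e = (x \<bullet> e) *\<^sub>R e"
      by (simp flip: mult.assoc)
  qed
  also have "\<dots> = x" by (rule onb_expand[OF onE x])
  finally show ?thesis .
qed

section \<open>Fractional powers under compression\<close>

text \<open>
  The integrand of the representation of $x^s$, up to a constant factor, as
  $\int_0^\infty t^{s-1}\frac{x}{x+t}\,dt$ for $0 < s < 1$. For the comparison of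
  two such integrals the constant only has to be finite and positive.
\<close>

definition resolvent_kernel :: "real \<Rightarrow> real \<Rightarrow> real \<Rightarrow> real" where
  "resolvent_kernel s x t = indicator {0<..} t * (t powr (s - 1) * (x / (x + t)))"

text \<open>The kernel is at most $t^{s-1}$ near $0$ and at most $t^{s-2}$ near infinity.\<close>

lemma integrable_resolvent_kernel_1:
  assumes s: "0 < s" "s < 1"
  shows "integrable lborel (resolvent_kernel s 1)"
proof (rule Bochner_Integration.integrable_bound[OF Bochner_Integration.integrable_add _ AE_I2])
  have "(\<lambda>t. t powr (s - 1)) absolutely_integrable_on {0..1}"
    using integrable_on_powr_from_0[of "s - 1" 1] s
    by (subst absolutely_integrable_on_iff_nonneg) auto
  then show "integrable lborel (\<lambda>t. indicat_real {0..1} t * t powr (s - 1))"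
    unfolding set_integrable_def by (subst (asm) integrable_completion) auto
  have "(\<lambda>t. t powr (s - 2)) absolutely_integrable_on {1..}"
    using has_integral_powr_to_inf[of "s - 2" 1] s
    by (subst absolutely_integrable_on_iff_nonneg) (auto simp: integrable_on_def)
  then show "integrable lborel (\<lambda>t. indicat_real {1..} t * t powr (s - 2))"
    unfolding set_integrable_def by (subst (asm) integrable_completion) auto
  show "resolvent_kernel s 1 \<in> borel_measurable lborel"
    unfolding resolvent_kernel_def by measurable
  fix t :: real
  have "resolvent_kernel s 1 t \<le> indicat_real {0..1} t * t powr (s - 1) + indicat_real {1..} t * t powr (s - 2)"
  proof (cases "0 < t")
    case t: True
    show ?thesis
    proof (cases "t \<le> 1")
      case True
      have "t powr (s - 1) * (1 / (1 + t)) \<le> t powr (s - 1) * 1"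
        using t by (intro mult_left_mono) (auto simp: field_simps)
      then show ?thesis
        using t True by (simp add: resolvent_kernel_def indicator_def add_increasing2)
    next
      case False
      have "t powr (s - 1) * (1 / (1 + t)) \<le> t powr (s - 1) * (1 / t)"
        using t by (intro mult_left_mono) (auto simp: field_simps)
      also have "\<dots> = t powr (s - 2)"
        using t by (simp add: powr_diff power2_eq_square field_simps)
      finally show ?thesis
        using t False by (simp add: resolvent_kernel_def indicator_def)
    qed
  qed (simp add: resolvent_kernel_def)
  moreover have "0 \<le> resolvent_kernel s 1 t"
    by (simp add: resolvent_kernel_def indicator_def)
  ultimately show "norm (resolvent_kernel s 1 t)
      \<le> norm (indicat_real {0..1} t * t powr (s - 1) + indicat_real {1..} t * t powr (s - 2))"
    by simp
qed

text \<open>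
  Substituting $xt$ for $t$ turns the integral for $x$ into $x^s$ times the integral for $1$.
\<close>

lemma resolvent_kernel_scale:
  assumes "0 < x"
  shows "resolvent_kernel s x (x * t) = x powr (s - 1) * resolvent_kernel s 1 t"
proof (cases "0 < t")
  case True
  have "x + x * t = x * (1 + t)"
    by (simp add: distrib_left)
  then have "x / (x + x * t) = 1 / (1 + t)"
    using assms by simp
  then show ?thesis
    using assms True by (simp add: resolvent_kernel_def powr_mult)
next
  case False
  then have "\<not> 0 < x * t"
    using assms by (simp add: zero_less_mult_iff)
  then show ?thesis
    using False by (simp add: resolvent_kernel_def)
qed

lemma integrable_resolvent_kernel:
  assumes s: "0 < s" "s < 1" and x: "0 < x"
  shows "integrable lborel (resolvent_kernel s x)"
proof -
  have "integrable lborel (\<lambda>t. resolvent_kernel s x (0 + x * t))"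
    using integrable_resolvent_kernel_1[OF s] by (simp add: resolvent_kernel_scale[OF x])
  then show ?thesis
    using x lborel_integrable_real_affine_iff[of x "resolvent_kernel s x" 0] by simp
qed

lemma integral_resolvent_kernel:
  assumes x: "0 < x"
  shows "integral\<^sup>L lborel (resolvent_kernel s x)
      = x powr s * integral\<^sup>L lborel (resolvent_kernel s 1)"
proof -
  have "integral\<^sup>L lborel (resolvent_kernel s x)
      = x * (\<integral>t. resolvent_kernel s x (0 + x * t) \<partial>lborel)"
    using x lborel_integral_real_affine[of x "resolvent_kernel s x" 0] by simp
  also have "\<dots> = x * x powr (s - 1) * integral\<^sup>L lborel (resolvent_kernel s 1)"
    by (simp add: resolvent_kernel_scale[OF x])
  also have "x * x powr (s - 1) = x powr s"
    using x by (simp add: powr_diff)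
  finally show ?thesis .
qed

lemma integral_resolvent_kernel_1_pos:
  assumes s: "0 < s" "s < 1"
  shows "0 < integral\<^sup>L lborel (resolvent_kernel s 1)"
proof -
  have int: "integrable lborel (\<lambda>t::real. indicat_real {0<..1} t * (1 / 2))"
    by (intro integrable_mult_left integrable_real_indicator) auto
  have "integral\<^sup>L lborel (\<lambda>t::real. indicat_real {0<..1} t * (1 / 2)) \<le> integral\<^sup>L lborel (resolvent_kernel s 1)"
  proof (rule integral_mono[OF int integrable_resolvent_kernel_1[OF s]])
    fix t :: real
    show "indicat_real {0<..1} t * (1 / 2) \<le> resolvent_kernel s 1 t"
    proof (cases "0 < t \<and> t \<le> 1")
      case True
      have "1 \<le> t powr (s - 1)"
        using True s powr_mono'[of "s - 1" 0 t] by simp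
      then have "1 * (1 / 2) \<le> t powr (s - 1) * (1 / (1 + t))"
        using True by (intro mult_mono) (auto simp: field_simps)
      then show ?thesis
        using True by (simp add: resolvent_kernel_def)
    next
      case False
      then show ?thesis
        by (auto simp: resolvent_kernel_def indicator_def)
    qed
  qed
  moreover have "integral\<^sup>L lborel (\<lambda>t::real. indicat_real {0<..1} t * (1 / 2)) = 1 / 2"
    by simp
  ultimately show ?thesis by linarith
qed

lemma resolvent_kernel_sum:
  fixes d n :: "'i \<Rightarrow> real"
  assumes s: "0 < s" "s < 1" and n: "\<And>j. j \<in> S \<Longrightarrow> 0 < n j"
  shows integrable_resolvent_kernel_sum:
      "integrable lborel (\<lambda>t. \<Sum>j\<in>S. resolvent_kernel s (n j) t * d j)"
    and integral_resolvent_kernel_sum: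
      "(\<integral>t. (\<Sum>j\<in>S. resolvent_kernel s (n j) t * d j) \<partial>lborel)
        = integral\<^sup>L lborel (resolvent_kernel s 1) * (\<Sum>j\<in>S. n j powr s * d j)"
proof -
  show "integrable lborel (\<lambda>t. \<Sum>j\<in>S. resolvent_kernel s (n j) t * d j)"
    by (intro Bochner_Integration.integrable_sum integrable_mult_left integrable_resolvent_kernel s n)
  have "(\<integral>t. (\<Sum>j\<in>S. resolvent_kernel s (n j) t * d j) \<partial>lborel)
      = (\<Sum>j\<in>S. (\<integral>t. resolvent_kernel s (n j) t * d j \<partial>lborel))"
    by (intro Bochner_Integration.integral_sum integrable_mult_left integrable_resolvent_kernel s n)
  also have "\<dots> = (\<Sum>j\<in>S. integral\<^sup>L lborel (resolvent_kernel s 1) * (n j powr s * d j))"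
  proof (intro sum.cong refl)
    fix j assume "j \<in> S"
    then have "integral\<^sup>L lborel (resolvent_kernel s (n j))
        = n j powr s * integral\<^sup>L lborel (resolvent_kernel s 1)"
      by (intro integral_resolvent_kernel n)
    then show "(\<integral>t. resolvent_kernel s (n j) t * d j \<partial>lborel)
        = integral\<^sup>L lborel (resolvent_kernel s 1) * (n j powr s * d j)"
      by simp
  qed
  finally show "(\<integral>t. (\<Sum>j\<in>S. resolvent_kernel s (n j) t * d j) \<partial>lborel)
        = integral\<^sup>L lborel (resolvent_kernel s 1) * (\<Sum>j\<in>S. n j powr s * d j)"
    by (simp add: sum_distrib_left)
qed

text \<open>
  A comparison of two discrete spectral measures on all functions $x/(x+t)$ passes to $x^s$,
  which is a positive superposition of them.
\<close>

lemma sum_powr_le_sum_powr: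
  fixes a l :: "'i \<Rightarrow> real" and b m :: "'j \<Rightarrow> real"
  assumes s: "0 < s" "s < 1" and fin: "finite I" "finite K"
    and pos: "\<And>i. i \<in> I \<Longrightarrow> 0 < l i" "\<And>k. k \<in> K \<Longrightarrow> 0 < m k"
    and le: "\<And>t. 0 < t \<Longrightarrow> (\<Sum>i\<in>I. l i / (l i + t) * a i) \<le> (\<Sum>k\<in>K. m k / (m k + t) * b k)"
  shows "(\<Sum>i\<in>I. l i powr s * a i) \<le> (\<Sum>k\<in>K. m k powr s * b k)"
proof -
  let ?c = "integral\<^sup>L lborel (resolvent_kernel s 1)"
  have "(\<integral>t. (\<Sum>i\<in>I. resolvent_kernel s (l i) t * a i) \<partial>lborel)
      \<le> (\<integral>t. (\<Sum>k\<in>K. resolvent_kernel s (m k) t * b k) \<partial>lborel)"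
  proof (rule integral_mono)
    fix t :: real
    show "(\<Sum>i\<in>I. resolvent_kernel s (l i) t * a i) \<le> (\<Sum>k\<in>K. resolvent_kernel s (m k) t * b k)"
    proof (cases "0 < t")
      case True
      have "t powr (s - 1) * (\<Sum>i\<in>I. l i / (l i + t) * a i)
          \<le> t powr (s - 1) * (\<Sum>k\<in>K. m k / (m k + t) * b k)"
        by (intro mult_left_mono le True) simp
      then show ?thesis
        using True by (simp add: resolvent_kernel_def sum_distrib_left mult.assoc)
    qed (simp add: resolvent_kernel_def)
  qed (intro integrable_resolvent_kernel_sum s pos; assumption)+
  moreover have "(\<integral>t. (\<Sum>i\<in>I. resolvent_kernel s (l i) t * a i) \<partial>lborel)
      = ?c * (\<Sum>i\<in>I. l i powr s * a i)"
    by (rule integral_resolvent_kernel_sum[OF s]) (rule pos)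
  moreover have "(\<integral>t. (\<Sum>k\<in>K. resolvent_kernel s (m k) t * b k) \<partial>lborel)
      = ?c * (\<Sum>k\<in>K. m k powr s * b k)"
    by (rule integral_resolvent_kernel_sum[OF s]) (rule pos)
  ultimately have "?c * (\<Sum>i\<in>I. l i powr s * a i) \<le> ?c * (\<Sum>k\<in>K. m k powr s * b k)"
    by (simp only:)
  then show ?thesis
    using integral_resolvent_kernel_1_pos[OF s] by simp
qed

lemma eigenbasis_quadratic_form:
  assumes A: "sym_pos_def_on V A" and E: "eigenbasis E V A" and x: "x \<in> V"
  shows "A x \<bullet> x = (\<Sum>e\<in>E. (A e \<bullet> e) * (x \<bullet> e)\<^sup>2)"
  unfolding onb_inner_expand[OF eigenbasis_onb[OF E] x]
  by (intro sum.cong refl) (simp add: eigenbasis_inner[OF A E x] power2_eq_square)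

lemma frac_power_1:
  assumes V: "finite_dim_subspace V" and A: "sym_pos_def_on V A" and x: "x \<in> V"
  shows "frac_power V A 1 x = A x"
proof -
  obtain E where E: "eigenbasis E V A"
    by (rule eigenbasis_exists[OF V A])
  have "frac_power V A 1 x = (\<Sum>e\<in>E. (A x \<bullet> e) *\<^sub>R e)"
    unfolding frac_power_eigenbasis[OF A E]
  proof (intro sum.cong refl)
    fix e assume e: "e \<in> E"
    show "((A e \<bullet> e) powr 1 * (x \<bullet> e)) *\<^sub>R e = (A x \<bullet> e) *\<^sub>R e"
      using eigenbasis_pos[OF A E e] eigenbasis_inner[OF A E x e] by simp
  qed
  also have "\<dots> = A x"
    by (rule onb_expand[OF eigenbasis_onb[OF E] sym_pos_def_on_mem[OF A x]])
  finally show ?thesis .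
qed

lemma frac_power_0:
  assumes V: "finite_dim_subspace V" and A: "sym_pos_def_on V A" and x: "x \<in> V"
  shows "frac_power V A 0 x = x"
proof -
  obtain E where E: "eigenbasis E V A"
    by (rule eigenbasis_exists[OF V A])
  have "frac_power V A 0 x = (\<Sum>e\<in>E. (x \<bullet> e) *\<^sub>R e)"
    unfolding frac_power_eigenbasis[OF A E]
  proof (intro sum.cong refl)
    fix e assume e: "e \<in> E"
    show "((A e \<bullet> e) powr 0 * (x \<bullet> e)) *\<^sub>R e = (x \<bullet> e) *\<^sub>R e"
      using eigenbasis_pos[OF A E e] by simp
  qed
  also have "\<dots> = x"
    by (rule onb_expand[OF eigenbasis_onb[OF E] x])
  finally show ?thesis .
qed

lemma sym_pos_def_on_surj:
  assumes V: "finite_dim_subspace V" and A: "sym_pos_def_on V A"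
  shows "A ` V = V"
proof (intro equalityI subsetI)
  fix x assume x: "x \<in> V"
  let ?y = "frac_power V A (- 1) x"
  have y: "?y \<in> V"
    by (rule sym_pos_def_on_mem[OF sym_pos_def_on_frac_power[OF V A] x])
  have "A ?y = x"
    using frac_power_frac_power_uminus[OF V A x, of 1] frac_power_1[OF V A y] by simp
  then show "x \<in> A ` V"
    using y by (auto intro: image_eqI[OF sym])
qed (use sym_pos_def_on_mem[OF A] in auto)

text \<open>
  The right-hand side is a quadratic polynomial in \<open>\<eta>\<close> with minimum at $\eta = t\xi/(l+t)$,
  and its minimal value is the left-hand side; the next lemma evaluates it there.
\<close>

lemma resolvent_le_penalized:
  fixes l t \<xi> \<eta> :: real
  assumes "0 < l" "0 < t"
  shows "l / (l + t) * \<xi>\<^sup>2 \<le> l * \<eta>\<^sup>2 / t + (\<xi> - \<eta>)\<^sup>2"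
proof -
  have pos: "0 < l + t" using assms by simp
  have distrib: "t * (l + t) * (X + Y - U * W) = (l + t) * (t * X) + t * (l + t) * Y - t * ((l + t) * U) * W"
    for X Y U W :: real
    by (simp add: algebra_simps)
  have "t * (l + t) * (l * \<eta>\<^sup>2 / t + (\<xi> - \<eta>)\<^sup>2 - l / (l + t) * \<xi>\<^sup>2)
      = (l + t) * (t * (l * \<eta>\<^sup>2 / t)) + t * (l + t) * (\<xi> - \<eta>)\<^sup>2
        - t * ((l + t) * (l / (l + t))) * \<xi>\<^sup>2"
    by (rule distrib)
  also have "\<dots> = (l + t) * (l * \<eta>\<^sup>2) + t * (l + t) * (\<xi> - \<eta>)\<^sup>2 - t * l * \<xi>\<^sup>2"
    using assms pos by simp
  also have "\<dots> = ((l + t) * \<eta> - t * \<xi>)\<^sup>2"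
    by (simp add: power2_eq_square algebra_simps)
  finally have "0 \<le> t * (l + t) * (l * \<eta>\<^sup>2 / t + (\<xi> - \<eta>)\<^sup>2 - l / (l + t) * \<xi>\<^sup>2)"
    by simp
  moreover have "0 < t * (l + t)"
    using assms pos by simp
  ultimately show ?thesis
    using mult_le_cancel_left_pos[of "t * (l + t)" 0] by simp
qed

lemma resolvent_eq_penalized:
  fixes m t \<xi> :: real
  assumes "0 < m" "0 < t"
  shows "m * (t / (m + t) * \<xi>)\<^sup>2 / t + (\<xi> - t / (m + t) * \<xi>)\<^sup>2 = m / (m + t) * \<xi>\<^sup>2"
proof -
  define u where "u = m + t"
  have u: "0 < u" "m = u - t" using assms by (auto simp: u_def)
  show ?thesis
    using assms u(1) unfolding u(2) by (simp add: power2_eq_square field_simps)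
qed

text \<open>
  In eigenbases of \<open>A\<close> and \<open>B\<close>, the claim compares $\sum\lambda^s(x,e)^2$ with
  $\sum\mu^s(x,f)^2$, so by \<open>sum_powr_le_sum_powr\<close> it is enough to compare the resolvent sums for
  each \<open>t\<close>. The vector \<open>v\<close> in the proof is the minimizer over \<open>W\<close> of
  $t^{-1}(Bv,v)+\|x-v\|^2$. It attains the resolvent sum of \<open>B\<close>, and it is also a competitor in
  the corresponding minimization over \<open>V\<close>, whose value is the resolvent sum of \<open>A\<close>.
\<close>

theorem frac_power_compression_le:
  assumes V: "finite_dim_subspace V" and A: "sym_pos_def_on V A"
    and W: "finite_dim_subspace W" and B: "sym_pos_def_on W B"
    and WV: "W \<subseteq> V" and compression: "\<And>x. x \<in> W \<Longrightarrow> B x \<bullet> x = A x \<bullet> x"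
    and s: "0 \<le> s" "s \<le> 1" and x: "x \<in> W"
  shows "frac_power V A s x \<bullet> x \<le> frac_power W B s x \<bullet> x"
proof -
  have xV: "x \<in> V" using x WV by auto
  consider "s = 0" | "s = 1" | "0 < s" "s < 1" using s by linarith
  then show ?thesis
  proof cases
    case 1
    then show ?thesis
      using frac_power_0[OF V A xV] frac_power_0[OF W B x] by simp
  next
    case 2
    then show ?thesis
      using frac_power_1[OF V A xV] frac_power_1[OF W B x] compression[OF x] by simp
  next
    case 3
    obtain E where E: "eigenbasis E V A"
      by (rule eigenbasis_exists[OF V A])
    obtain F where F: "eigenbasis F W B"
      by (rule eigenbasis_exists[OF W B])
    have onE: "onb E V" and onF: "onb F W"
      using E F by (auto dest: eigenbasis_onb)
    have "(\<Sum>e\<in>E. (A e \<bullet> e) powr s * (x \<bullet> e)\<^sup>2) \<le> (\<Sum>f\<in>F. (B f \<bullet> f) powr s * (x \<bullet> f)\<^sup>2)"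
    proof (rule sum_powr_le_sum_powr[OF 3 onb_finite[OF onE] onb_finite[OF onF]])
      show "0 < A e \<bullet> e" if "e \<in> E" for e by (rule eigenbasis_pos[OF A E that])
      show "0 < B f \<bullet> f" if "f \<in> F" for f by (rule eigenbasis_pos[OF B F that])
      fix t :: real assume t: "0 < t"
      define v where "v = (\<Sum>f\<in>F. (t / (B f \<bullet> f + t) * (x \<bullet> f)) *\<^sub>R f)"
      have v: "v \<in> W" "v \<in> V" and xv: "x - v \<in> W" "x - v \<in> V"
        using onb_sum_mem[OF onF] WV x subspace_diff[OF onb_subspace[OF onF]] unfolding v_def by auto
      have vf: "v \<bullet> f = t / (B f \<bullet> f + t) * (x \<bullet> f)" if "f \<in> F" for f
        unfolding v_def by (rule inner_orthonormal_sum[OF onF that])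
      have "(\<Sum>e\<in>E. A e \<bullet> e / (A e \<bullet> e + t) * (x \<bullet> e)\<^sup>2)
          \<le> (\<Sum>e\<in>E. (A e \<bullet> e) * (v \<bullet> e)\<^sup>2 / t + (x \<bullet> e - v \<bullet> e)\<^sup>2)"
        by (intro sum_mono resolvent_le_penalized t eigenbasis_pos[OF A E])
      also have "\<dots> = A v \<bullet> v / t + (x - v) \<bullet> (x - v)"
        unfolding eigenbasis_quadratic_form[OF A E v(2)] onb_inner_expand[OF onE xv(2)]
        by (simp add: sum.distrib sum_divide_distrib inner_diff_left power2_eq_square)
      also have "\<dots> = B v \<bullet> v / t + (x - v) \<bullet> (x - v)"
        using compression[OF v(1)] by simp
      also have "\<dots> = (\<Sum>f\<in>F. (B f \<bullet> f) * (v \<bullet> f)\<^sup>2 / t + (x \<bullet> f - v \<bullet> f)\<^sup>2)"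
        unfolding eigenbasis_quadratic_form[OF B F v(1)] onb_inner_expand[OF onF xv(1)]
        by (simp add: sum.distrib sum_divide_distrib inner_diff_left power2_eq_square)
      also have "\<dots> = (\<Sum>f\<in>F. B f \<bullet> f / (B f \<bullet> f + t) * (x \<bullet> f)\<^sup>2)"
        by (intro sum.cong refl) (simp only: vf resolvent_eq_penalized[OF eigenbasis_pos[OF B F] t])
      finally show "(\<Sum>e\<in>E. A e \<bullet> e / (A e \<bullet> e + t) * (x \<bullet> e)\<^sup>2)
          \<le> (\<Sum>f\<in>F. B f \<bullet> f / (B f \<bullet> f + t) * (x \<bullet> f)\<^sup>2)" .
    qed
    then show ?thesis
      by (simp add: inner_frac_power[OF A E xV] inner_frac_power[OF B F x] power2_eq_square mult.assoc)
  qed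
qed

section \<open>Additive preconditioners on a hierarchy of nested spaces\<close>

text \<open>
  The abstract situation behind the estimates: the energy \<open>L k x \<bullet> x\<close> of a vector does not
  increase from one level to the next finer one. The operators \<open>L k\<close> stand for $\Lambda_k^s$.
\<close>

locale nested_forms =
  fixes V :: "nat \<Rightarrow> 'a::real_inner set" and L :: "nat \<Rightarrow> 'a \<Rightarrow> 'a" and J :: nat
  assumes finite_dim: "k \<in> {1..J} \<Longrightarrow> finite_dim_subspace (V k)"
    and nested: "k \<in> {2..J} \<Longrightarrow> V (k - 1) \<subseteq> V k"
    and L_spd: "k \<in> {1..J} \<Longrightarrow> sym_pos_def_on (V k) (L k)"
    and L_antimono: "k \<in> {2..J} \<Longrightarrow> x \<in> V (k - 1) \<Longrightarrow> L k x \<bullet> x \<le> L (k - 1) x \<bullet> x"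
begin

lemma V_subspace: "k \<in> {1..J} \<Longrightarrow> subspace (V k)"
  using finite_dim[of k] subspace_span unfolding finite_dim_subspace_def by metis

lemma V_mono:
  assumes "1 \<le> i" "i \<le> k" "k \<le> J"
  shows "V i \<subseteq> V k"
  using assms(2,3)
proof (induction k rule: dec_induct)
  case (step k)
  then show ?case using nested[of "Suc k"] assms(1) by auto
qed simp

lemma L_le:
  assumes "1 \<le> i" "i \<le> k" "k \<le> J" "x \<in> V i"
  shows "L k x \<bullet> x \<le> L i x \<bullet> x"
  using assms(2,3)
proof (induction k rule: dec_induct)
  case (step k)
  then have "x \<in> V k"
    using V_mono[of i k] assms by auto
  then show ?case
    using L_antimono[of "Suc k" x] step assms(1) by auto
qed simp

lemma oproj_V:
  assumes "k \<in> {1..J}"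
  shows "oproj (V k) x \<in> V k" and "w \<in> V k \<Longrightarrow> oproj (V k) x \<bullet> w = x \<bullet> w"
proof -
  obtain E where "onb E (V k)"
    by (rule finite_dim_subspace_onb[OF finite_dim[OF assms]])
  then show "oproj (V k) x \<in> V k" and "w \<in> V k \<Longrightarrow> oproj (V k) x \<bullet> w = x \<bullet> w"
    by (rule oproj_mem, rule inner_oproj)
qed

text \<open>Each \<open>R k\<close> maps into \<open>V k\<close>, so \<open>f\<close> can be replaced by its projection.\<close>

lemma inner_B_op:
  assumes R: "\<And>k. k \<in> {1..J} \<Longrightarrow> sym_pos_def_on (V k) (R k)"
  shows "B_op V R J f \<bullet> f = (\<Sum>k=1..J. R k (oproj (V k) f) \<bullet> oproj (V k) f)"
  unfolding B_op_def inner_sum_left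
proof (intro sum.cong refl)
  fix k assume k: "k \<in> {1..J}"
  have "R k (oproj (V k) f) \<in> V k"
    by (rule sym_pos_def_on_mem[OF R[OF k] oproj_V(1)[OF k]])
  then show "R k (oproj (V k) f) \<bullet> f = R k (oproj (V k) f) \<bullet> oproj (V k) f"
    using oproj_V(2)[OF k, of "R k (oproj (V k) f)" f]
    by (simp add: inner_commute[of f] inner_commute[of "oproj (V k) f"])
qed

text \<open>
  This is $(L_k^{-1}Q_kL_Jx,Q_kL_Jx) \le (L_Jx,x)$ with $u = L_k^{-1}Q_kL_Jx$. Both
  $(u,Q_kL_Jx) = (L_Ju,x)$ and $(u,Q_kL_Jx) = (L_ku,u)$ hold, so the Cauchy-Schwarz inequality for
  \<open>L J\<close> and the comparison of energies bound the square of this number by its product with the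
  right-hand side.
\<close>

lemma inverse_form_oproj_le:
  assumes k: "k \<in> {1..J}" and x: "x \<in> V J"
    and u: "u \<in> V k" "L k u = oproj (V k) (L J x)"
  shows "u \<bullet> oproj (V k) (L J x) \<le> L J x \<bullet> x"
proof -
  have J: "J \<in> {1..J}" using k by auto
  have uJ: "u \<in> V J" using V_mono[of k J] k u by auto
  let ?a = "u \<bullet> oproj (V k) (L J x)"
  have a1: "?a = L J u \<bullet> x"
    using oproj_V(2)[OF k u(1), of "L J x"] sym_pos_def_on_sym[OF L_spd[OF J] uJ x]
    by (simp add: inner_commute)
  have a2: "?a = L k u \<bullet> u"
    using u(2) by (simp add: inner_commute)
  have a0: "0 \<le> ?a"
    unfolding a2 by (rule sym_pos_def_on_inner_nonneg[OF L_spd[OF k] V_subspace[OF k] u(1)])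
  have x0: "0 \<le> L J x \<bullet> x"
    by (rule sym_pos_def_on_inner_nonneg[OF L_spd[OF J] V_subspace[OF J] x])
  have "?a\<^sup>2 \<le> (L J u \<bullet> u) * (L J x \<bullet> x)"
    unfolding a1 by (rule sym_pos_def_on_Cauchy_Schwarz[OF L_spd[OF J] V_subspace[OF J] uJ x])
  also have "\<dots> \<le> ?a * (L J x \<bullet> x)"
    unfolding a2 by (intro mult_right_mono L_le x0) (use k u in auto)
  finally have "?a * ?a \<le> ?a * (L J x \<bullet> x)"
    by (simp add: power2_eq_square)
  then show ?thesis
    using a0 x0 by (cases "?a = 0") auto
qed

text \<open>
  The operators \<open>M k\<close> stand for $\Lambda_k^{-s}$. The assumption on \<open>R k\<close> and
  \<open>inverse_form_oproj_le\<close> bound each of the \<open>J\<close> summands of \<open>inner_B_op\<close> by the same quantity.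
\<close>

theorem B_op_upper_bound:
  assumes R: "\<And>k. k \<in> {1..J} \<Longrightarrow> sym_pos_def_on (V k) (R k)"
    and M: "\<And>k y. k \<in> {1..J} \<Longrightarrow> y \<in> V k \<Longrightarrow> M k y \<in> V k \<and> L k (M k y) = y"
    and R_le: "\<And>k y. k \<in> {1..J} \<Longrightarrow> y \<in> V k \<Longrightarrow> R k y \<bullet> y \<le> C * (M k y \<bullet> y)"
    and C: "0 \<le> C" and x: "x \<in> V J"
  shows "B_op V R J (L J x) \<bullet> L J x \<le> C * real J * (L J x \<bullet> x)"
proof -
  let ?q = "\<lambda>k. oproj (V k) (L J x)"
  have "R k (?q k) \<bullet> ?q k \<le> C * (L J x \<bullet> x)" if k: "k \<in> {1..J}" for k
  proof -
    have "R k (?q k) \<bullet> ?q k \<le> C * (M k (?q k) \<bullet> ?q k)"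
      by (rule R_le[OF k oproj_V(1)[OF k]])
    also have "\<dots> \<le> C * (L J x \<bullet> x)"
      using M[OF k oproj_V(1)[OF k]] by (intro mult_left_mono C inverse_form_oproj_le k x) auto
    finally show ?thesis .
  qed
  then have "(\<Sum>k=1..J. R k (?q k) \<bullet> ?q k) \<le> (\<Sum>k=1..J. C * (L J x \<bullet> x))"
    by (intro sum_mono)
  moreover have "B_op V R J (L J x) \<bullet> L J x = (\<Sum>k=1..J. R k (?q k) \<bullet> ?q k)"
    by (rule inner_B_op[OF R])
  ultimately show ?thesis
    by (simp add: mult_ac)
qed

text \<open>
  With $p = P_kx$, the definition of $P_k$ gives $(L_kx,p) = (L_{k-1}p,p)$. Expanding the square,
  and using that the energy of \<open>p\<close> on level $k$ is at most that on level $k-1$,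
  $(L_k(x-p),x-p) \le (L_kx,x) - (L_{k-1}p,p)$. Iterating with \<open>p\<close> in place of \<open>x\<close> makes the
  energies telescope. The vectors \<open>z i\<close> are the successive images of \<open>x\<close>, with \<open>z k = x\<close>.
\<close>

lemma telescoping_decomposition:
  assumes P0: "P 1 = (\<lambda>x. 0)"
    and P: "\<And>k x. k \<in> {2..J} \<Longrightarrow> x \<in> V k \<Longrightarrow> P k x \<in> V (k - 1)"
    and P_form: "\<And>k x y. k \<in> {2..J} \<Longrightarrow> x \<in> V k \<Longrightarrow> y \<in> V (k - 1) \<Longrightarrow> L (k - 1) (P k x) \<bullet> y = L k x \<bullet> y"
    and k: "1 \<le> k" "k \<le> J" and x: "x \<in> V k"
  obtains z where "\<And>i. i \<in> {1..k} \<Longrightarrow> z i \<in> V i" "(\<Sum>i=1..k. z i - P i (z i)) = x"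
    "(\<Sum>i=1..k. L i (z i - P i (z i)) \<bullet> (z i - P i (z i))) \<le> L k x \<bullet> x"
proof -
  have "\<exists>z. (\<forall>i\<in>{1..k}. z i \<in> V i) \<and> (\<Sum>i=1..k. z i - P i (z i)) = x \<and>
      (\<Sum>i=1..k. L i (z i - P i (z i)) \<bullet> (z i - P i (z i))) \<le> L k x \<bullet> x"
    using k x
  proof (induction k arbitrary: x rule: dec_induct)
    case base
    then show ?case
      using P0 by (intro exI[of _ "\<lambda>_. x"]) simp
  next
    case (step k)
    have k: "Suc k \<in> {2..J}" "Suc k \<in> {1..J}" "k \<in> {1..J}" using step by auto
    define p where "p = P (Suc k) x"
    have p: "p \<in> V k" using P[OF k(1) step.prems(2)] by (simp add: p_def)
    then have p': "p \<in> V (Suc k)" using nested[OF k(1)] by auto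
    obtain z where z: "\<forall>i\<in>{1..k}. z i \<in> V i" "(\<Sum>i=1..k. z i - P i (z i)) = p"
      "(\<Sum>i=1..k. L i (z i - P i (z i)) \<bullet> (z i - P i (z i))) \<le> L k p \<bullet> p"
      using step.IH[OF _ p] step.prems by auto
    define y where "y = z(Suc k := x)"
    have y: "y i = z i" if "i \<in> {1..k}" for i using that by (auto simp: y_def)
    have "L (Suc k) (x - p) \<bullet> (x - p)
        = L (Suc k) x \<bullet> x - 2 * (L (Suc k) x \<bullet> p) + L (Suc k) p \<bullet> p"
      using sym_pos_def_on_diff[OF L_spd[OF k(2)] V_subspace[OF k(2)] step.prems(2) p']
        sym_pos_def_on_sym[OF L_spd[OF k(2)] p' step.prems(2)]
      by (simp add: inner_diff_left inner_diff_right inner_commute[of p "L (Suc k) x"])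
    also have "L (Suc k) x \<bullet> p = L k p \<bullet> p"
      using P_form[OF k(1) step.prems(2), of p] p by (simp add: p_def)
    also have "L (Suc k) p \<bullet> p \<le> L k p \<bullet> p"
      using L_antimono[OF k(1), of p] p by simp
    finally have "L (Suc k) (x - p) \<bullet> (x - p) \<le> L (Suc k) x \<bullet> x - L k p \<bullet> p"
      by simp
    moreover have "(\<Sum>i=1..k. L i (y i - P i (y i)) \<bullet> (y i - P i (y i)))
        = (\<Sum>i=1..k. L i (z i - P i (z i)) \<bullet> (z i - P i (z i)))"
      by (intro sum.cong refl) (simp only: y)
    ultimately have "(\<Sum>i=1..Suc k. L i (y i - P i (y i)) \<bullet> (y i - P i (y i))) \<le> L (Suc k) x \<bullet> x"
      using z(3) by (simp add: y_def p_def)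
    moreover have "(\<Sum>i=1..k. y i - P i (y i)) = p"
      unfolding z(2)[symmetric] by (intro sum.cong refl) (simp only: y)
    then have "(\<Sum>i=1..Suc k. y i - P i (y i)) = x"
      by (simp add: y_def p_def)
    moreover have "\<forall>i\<in>{1..Suc k}. y i \<in> V i"
      using z(1) step.prems by (auto simp: y_def le_Suc_eq)
    ultimately show ?case by blast
  qed
  then show ?thesis using that by blast
qed

text \<open>
  Let $v_i = z_i - P_iz_i$ be the parts of \<open>x\<close>, $q_i = Q_iL_Jx$ and $w_i = R_i^{-1}v_i$. Positivity
  of $R_i$ at $Cq_i-w_i$ gives
  $2C(q_i,v_i) \le C^2(R_iq_i,q_i) + (w_i,v_i)$. In the sum over \<open>i\<close> the left-hand side is
  $2C(L_Jx,x)$, while the last terms contribute at most $C(L_Jx,x)$ by the assumed bound on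
  $R_i^{-1}$ and the telescoping energies; half of the left-hand side absorbs them.
\<close>

theorem B_op_lower_bound:
  assumes R: "\<And>k. k \<in> {1..J} \<Longrightarrow> sym_pos_def_on (V k) (R k)"
    and P0: "P 1 = (\<lambda>x. 0)"
    and P: "\<And>k x. k \<in> {2..J} \<Longrightarrow> x \<in> V k \<Longrightarrow> P k x \<in> V (k - 1)"
    and P_form: "\<And>k x y. k \<in> {2..J} \<Longrightarrow> x \<in> V k \<Longrightarrow> y \<in> V (k - 1) \<Longrightarrow> L (k - 1) (P k x) \<bullet> y = L k x \<bullet> y"
    and R_inv_le: "\<And>k y. k \<in> {1..J} \<Longrightarrow> y \<in> V k \<Longrightarrow>
        inv_into (V k) (R k) (y - P k y) \<bullet> (y - P k y) \<le> C * (L k (y - P k y) \<bullet> (y - P k y))"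
    and C: "0 < C" and J: "1 \<le> J" and x: "x \<in> V J"
  shows "inverse C * (L J x \<bullet> x) \<le> B_op V R J (L J x) \<bullet> L J x"
proof -
  obtain z where z: "\<And>i. i \<in> {1..J} \<Longrightarrow> z i \<in> V i"
    and sum: "(\<Sum>i=1..J. z i - P i (z i)) = x"
    and energy: "(\<Sum>i=1..J. L i (z i - P i (z i)) \<bullet> (z i - P i (z i))) \<le> L J x \<bullet> x"
    using telescoping_decomposition[OF P0 P P_form J order_refl x] by blast
  define v where "v i = z i - P i (z i)" for i
  define q where "q i = oproj (V i) (L J x)" for i
  have v: "v i \<in> V i" if i: "i \<in> {1..J}" for i
  proof (cases "i = 1")
    case True
    then show ?thesis using z[OF i] P0 by (simp add: v_def)
  next
    case False
    then have i2: "i \<in> {2..J}" using i by auto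
    then have "P i (z i) \<in> V i" using P[OF i2 z[OF i]] nested[OF i2] by auto
    then show ?thesis
      unfolding v_def by (rule subspace_diff[OF V_subspace[OF i] z[OF i]])
  qed
  have q: "q i \<in> V i" if "i \<in> {1..J}" for i
    unfolding q_def by (rule oproj_V(1)[OF that])
  have step: "2 * C * (L J x \<bullet> v i) \<le> C\<^sup>2 * (R i (q i) \<bullet> q i) + C * (L i (v i) \<bullet> v i)"
    if i: "i \<in> {1..J}" for i
  proof -
    define w where "w = inv_into (V i) (R i) (v i)"
    have "v i \<in> R i ` V i"
      using v[OF i] sym_pos_def_on_surj[OF finite_dim[OF i] R[OF i]] by simp
    then have w: "w \<in> V i" and Rw: "R i w = v i"
      unfolding w_def by (rule inv_into_into, rule f_inv_into_f)
    have Cq: "C *\<^sub>R q i \<in> V i"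
      by (rule subspace_scale[OF V_subspace[OF i] q[OF i]])
    have "0 \<le> R i (C *\<^sub>R q i - w) \<bullet> (C *\<^sub>R q i - w)"
      by (rule sym_pos_def_on_inner_nonneg[OF R[OF i] V_subspace[OF i]
            subspace_diff[OF V_subspace[OF i] Cq w]])
    also have "\<dots> = C\<^sup>2 * (R i (q i) \<bullet> q i) - 2 * C * (q i \<bullet> v i) + w \<bullet> v i"
    proof -
      have "R i (C *\<^sub>R q i - w) = C *\<^sub>R R i (q i) - v i"
        using sym_pos_def_on_diff[OF R[OF i] V_subspace[OF i] Cq w]
          sym_pos_def_on_scale[OF R[OF i] q[OF i]] Rw by simp
      moreover have "R i (q i) \<bullet> w = q i \<bullet> v i"
        using sym_pos_def_on_sym[OF R[OF i] q[OF i] w] Rw by simp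
      ultimately show ?thesis
        by (simp add: inner_diff_left inner_diff_right power2_eq_square inner_commute[of "v i"]
            right_diff_distrib)
    qed
    also have "q i \<bullet> v i = L J x \<bullet> v i"
      unfolding q_def by (rule oproj_V(2)[OF i v[OF i]])
    also have "w \<bullet> v i \<le> C * (L i (v i) \<bullet> v i)"
      using R_inv_le[OF i z[OF i]] by (simp add: w_def v_def)
    finally show ?thesis by simp
  qed
  have "2 * C * (L J x \<bullet> x) = (\<Sum>i=1..J. 2 * C * (L J x \<bullet> v i))"
    by (subst (2) sum[symmetric]) (simp add: v_def inner_sum_right sum_distrib_left)
  also have "\<dots> \<le> (\<Sum>i=1..J. C\<^sup>2 * (R i (q i) \<bullet> q i) + C * (L i (v i) \<bullet> v i))"
    by (intro sum_mono step)
  also have "\<dots> = C\<^sup>2 * (B_op V R J (L J x) \<bullet> L J x) + C * (\<Sum>i=1..J. L i (v i) \<bullet> v i)"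
    by (subst inner_B_op[OF R]) (simp_all add: q_def sum.distrib sum_distrib_left)
  also have "\<dots> \<le> C\<^sup>2 * (B_op V R J (L J x) \<bullet> L J x) + C * (L J x \<bullet> x)"
    using energy C by (simp add: v_def)
  finally have "C * (L J x \<bullet> x) \<le> C * (C * (B_op V R J (L J x) \<bullet> L J x))"
    by (simp add: power2_eq_square mult.assoc)
  then have "L J x \<bullet> x \<le> C * (B_op V R J (L J x) \<bullet> L J x)"
    using C by simp
  then show ?thesis
    using C by (simp add: field_simps)
qed

end

section \<open>The fundamental lemma of the calculus of variations\<close>

text \<open>
  The functions $t^{-k}e^{-1/t}$ on the positive half-line, extended by zero. The derivative of
  each is a combination of two others, so the family contains the derivatives of all orders of the
  flat function $e^{-1/t}$ up to linear combinations.
\<close>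

definition flat :: "nat \<Rightarrow> real \<Rightarrow> real" where
  "flat k t = (if 0 < t then inverse t ^ k * exp (- inverse t) else 0)"

lemma flat_tendsto_0: "(flat k \<longlongrightarrow> 0) (at 0)"
proof (rule filterlim_split_at)
  have "\<forall>\<^sub>F t in at_left 0. 0 = flat k t"
    by (auto simp: flat_def eventually_at_filter)
  then show "(flat k \<longlongrightarrow> 0) (at_left 0)"
    by (rule Lim_transform_eventually[OF tendsto_const])
  have "((\<lambda>t. inverse t ^ k / exp (inverse t)) \<longlongrightarrow> (0::real)) (at_right 0)"
    by (rule filterlim_compose[OF tendsto_power_div_exp_0 filterlim_inverse_at_top_right])
  moreover have "\<forall>\<^sub>F t in at_right 0. inverse t ^ k / exp (inverse t) = flat k t"
    by (auto simp: eventually_at_right_less flat_def exp_minus divide_inverse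
        intro: eventually_mono[OF eventually_at_right_less[of 0]])
  ultimately show "(flat k \<longlongrightarrow> 0) (at_right 0)"
    by (rule Lim_transform_eventually)
qed

text \<open>
  At \<open>0\<close> the difference quotient of \<open>flat k\<close> is \<open>flat (k + 1)\<close>, which tends to \<open>0\<close>.
\<close>

lemma DERIV_flat: "DERIV (flat k) t :> flat (k + 2) t - real k * flat (k + 1) t"
proof -
  consider "0 < t" | "t < 0" | "t = 0" by linarith
  then show ?thesis
  proof cases
    case 1
    have "DERIV (\<lambda>t. inverse t ^ k * exp (- inverse t)) t :> flat (k + 2) t - real k * flat (k + 1) t"
    proof -
      have e: "DERIV (\<lambda>t. exp (- inverse t)) t :> inverse t ^ 2 * exp (- inverse t)"
        using 1 by (auto intro!: derivative_eq_intros simp: power2_eq_square)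
      show ?thesis
      proof (cases k)
        case 0
        then show ?thesis
          using e 1 by (simp add: flat_def power2_eq_square)
      next
        case (Suc n)
        have "DERIV (\<lambda>t. inverse t ^ Suc n) t :> (1 + real n) * (- (inverse t ^ Suc (Suc 0)) * inverse t ^ n)"
          using 1 by (intro DERIV_power_Suc DERIV_inverse) simp
        from DERIV_mult[OF this e] show ?thesis
          unfolding Suc
          by (rule DERIV_cong) (use 1 in \<open>auto simp: flat_def power2_eq_square algebra_simps\<close>)
      qed
    qed
    then show ?thesis
      by (rule has_field_derivative_transform_within_open[of _ _ _ "{0<..}"])
        (use 1 in \<open>auto simp: flat_def\<close>)
  next
    case 2
    have "DERIV (\<lambda>t. 0) t :> (0::real)" by simp
    then have "DERIV (flat k) t :> 0"
      by (rule has_field_derivative_transform_within_open[of _ _ _ "{..<0}"])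
        (use 2 in \<open>auto simp: flat_def\<close>)
    then show ?thesis
      using 2 by (simp add: flat_def)
  next
    case 3
    have "(flat k (0 + h) - flat k 0) / h = flat (k + 1) h" for h
      by (simp add: flat_def field_simps)
    then have "DERIV (flat k) 0 :> 0"
      unfolding DERIV_def using flat_tendsto_0[of "k + 1"] by simp
    then show ?thesis
      using 3 by (simp add: flat_def)
  qed
qed

text \<open>
  A class of functions closed under taking components of gradients, so that all its members are
  infinitely differentiable. It is not the class of all smooth functions, but large enough to
  contain the bump functions below.
\<close>

inductive smooth :: "(real^'n \<Rightarrow> real) \<Rightarrow> bool" where
  smooth_const: "smooth (\<lambda>x. c)"
| smooth_flat: "smooth (\<lambda>x. flat k (a * x $ i + b))"
| smooth_add: "smooth f \<Longrightarrow> smooth g \<Longrightarrow> smooth (\<lambda>x. f x + g x)"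
| smooth_mult: "smooth f \<Longrightarrow> smooth g \<Longrightarrow> smooth (\<lambda>x. f x * g x)"

lemma smooth_gderiv:
  fixes \<phi> :: "real^'n \<Rightarrow> real"
  shows "smooth \<phi> \<Longrightarrow> \<exists>G. (\<forall>x. GDERIV \<phi> x :> G x) \<and> (\<forall>i. smooth (\<lambda>x. G x $ i))"
proof (induction rule: smooth.induct)
  case (smooth_const c)
  show ?case
    by (rule exI[of _ "\<lambda>x. 0"]) (auto intro: GDERIV_const smooth.smooth_const)
next
  case (smooth_flat k a i b)
  let ?y = "\<lambda>x :: real^'n. a * x $ i + b"
  let ?d = "\<lambda>x. flat (k + 2) (?y x) + (- real k) * flat (k + 1) (?y x)"
  have "GDERIV ?y x :> a *\<^sub>R axis i 1" for x :: "real^'n"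
  proof -
    have "bounded_linear (\<lambda>x::real^'n. a * x $ i)"
      by (intro bounded_linear_const_mult bounded_linear_vec_nth)
    then have "(?y has_derivative (\<lambda>h. a * h $ i)) (at x)"
      by (intro has_derivative_add_const bounded_linear_imp_has_derivative)
    then show ?thesis
      by (simp add: gderiv_def inner_axis mult.commute)
  qed
  from GDERIV_DERIV_compose[OF this DERIV_flat]
  have "GDERIV (\<lambda>x. flat k (?y x)) x :> ?d x *\<^sub>R (a *\<^sub>R axis i 1)" for x :: "real^'n"
    by simp
  moreover have "smooth (\<lambda>x. (?d x *\<^sub>R (a *\<^sub>R axis i 1)) $ j)" for j
  proof -
    have "smooth (\<lambda>x. ?d x * (a * axis i 1 $ j))"
      by (intro smooth.intros)
    then show ?thesis by (simp add: mult.assoc)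
  qed
  ultimately show ?case
    by (intro exI[of _ "\<lambda>x. ?d x *\<^sub>R (a *\<^sub>R axis i 1)"] conjI allI)
next
  case (smooth_add f g)
  then obtain F G where "\<forall>x. GDERIV f x :> F x" "\<forall>i. smooth (\<lambda>x. F x $ i)"
    "\<forall>x. GDERIV g x :> G x" "\<forall>i. smooth (\<lambda>x. G x $ i)" by blast
  then show ?case
    by (intro exI[of _ "\<lambda>x. F x + G x"]) (auto intro: GDERIV_add smooth.smooth_add)
next
  case (smooth_mult f g)
  then obtain F G where "\<forall>x. GDERIV f x :> F x" "\<forall>i. smooth (\<lambda>x. F x $ i)"
    "\<forall>x. GDERIV g x :> G x" "\<forall>i. smooth (\<lambda>x. G x $ i)" by blast
  then show ?case
    by (intro exI[of _ "\<lambda>x. f x *\<^sub>R G x + g x *\<^sub>R F x"])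
      (auto intro!: GDERIV_mult smooth.smooth_add smooth.smooth_mult smooth_mult.hyps)
qed

lemma smooth_Ck: "smooth \<phi> \<Longrightarrow> Ck k \<phi>"
proof (induction k arbitrary: \<phi>)
  case 0
  obtain G where "\<forall>x. GDERIV \<phi> x :> G x"
    using smooth_gderiv[OF 0] by blast
  then have "continuous (at x) \<phi>" for x
    unfolding gderiv_def by (auto intro: has_derivative_continuous)
  then show ?case
    by (simp add: continuous_on_eq_continuous_at)
next
  case (Suc k)
  then show ?case
    using smooth_gderiv[OF Suc.prems] by fastforce
qed

lemma smooth_prod:
  "finite I \<Longrightarrow> (\<And>i. i \<in> I \<Longrightarrow> smooth (f i)) \<Longrightarrow> smooth (\<lambda>x. \<Prod>i\<in>I. f i x)"
  by (induction I rule: finite_induct) (auto intro: smooth.intros)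

text \<open>
  Positive exactly on the open box between \<open>l\<close> and \<open>u\<close> when \<open>0 < m\<close>, and increasing to the
  indicator function of that box as \<open>m\<close> tends to infinity.
\<close>

definition bump :: "real \<Rightarrow> real^'n \<Rightarrow> real^'n \<Rightarrow> real^'n \<Rightarrow> real" where
  "bump m l u x = (\<Prod>i\<in>UNIV. flat 0 (m * (x $ i - l $ i)) * flat 0 (m * (u $ i - x $ i)))"

lemma smooth_bump: "smooth (bump m l u)"
proof -
  have "smooth (\<lambda>x. flat 0 (m * x $ i + - m * l $ i) * flat 0 (- m * x $ i + m * u $ i))" for i
    by (intro smooth.intros)
  then have "smooth (\<lambda>x. flat 0 (m * (x $ i - l $ i)) * flat 0 (m * (u $ i - x $ i)))" for i
    by (simp add: algebra_simps)
  then show ?thesis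
    unfolding bump_def[abs_def] by (intro smooth_prod) auto
qed

lemma flat_0_bounds: "0 \<le> flat 0 t" "flat 0 t \<le> 1"
  by (auto simp: flat_def)

lemma bump_bounds: "0 \<le> bump m l u x" "bump m l u x \<le> 1"
  unfolding bump_def by (auto intro!: prod_nonneg prod_le_1 mult_nonneg_nonneg mult_le_one flat_0_bounds)

lemma bump_eq_0:
  assumes "0 < m" "x \<notin> box l u"
  shows "bump m l u x = 0"
proof -
  obtain i where "\<not> (l $ i < x $ i \<and> x $ i < u $ i)"
    using assms(2) by (auto simp: mem_box_cart)
  then have "flat 0 (m * (x $ i - l $ i)) * flat 0 (m * (u $ i - x $ i)) = 0"
    using assms(1) by (auto simp: flat_def zero_less_mult_iff)
  then show ?thesis
    unfolding bump_def by (intro prod_zero) auto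
qed

lemma bump_tendsto_1:
  assumes "x \<in> box l u"
  shows "(\<lambda>m. bump (real (Suc m)) l u x) \<longlonglongrightarrow> 1"
proof -
  have flat: "(\<lambda>m. flat 0 (real (Suc m) * c)) \<longlonglongrightarrow> 1" if c: "0 < c" for c
  proof -
    have "(\<lambda>m. inverse c * inverse (real (Suc m))) \<longlonglongrightarrow> inverse c * 0"
      by (intro tendsto_mult tendsto_const LIMSEQ_inverse_real_of_nat)
    then have "(\<lambda>m. exp (- (inverse c * inverse (real (Suc m))))) \<longlonglongrightarrow> exp (- (inverse c * 0))"
      by (intro tendsto_exp tendsto_minus)
    then show ?thesis
      using c by (simp add: flat_def mult.commute zero_less_mult_iff)
  qed
  have "(\<lambda>m. bump (real (Suc m)) l u x) \<longlonglongrightarrow> (\<Prod>i\<in>(UNIV::'a set). 1 * 1)"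
    unfolding bump_def
    by (intro tendsto_prod tendsto_mult flat) (use assms in \<open>auto simp: mem_box_cart\<close>)
  then show ?thesis by simp
qed

lemma test_fun_bump:
  assumes "0 < m" "cbox l u \<subseteq> \<Omega>"
  shows "test_fun \<Omega> (bump m l u)"
proof -
  have "{x. bump m l u x \<noteq> 0} \<subseteq> cbox l u"
    using bump_eq_0[OF assms(1)] box_subset_cbox by blast
  then have sub: "closure {x. bump m l u x \<noteq> 0} \<subseteq> cbox l u"
    by (intro closure_minimal closed_cbox)
  have "compact (cbox l u \<inter> closure {x. bump m l u x \<noteq> 0})"
    by (intro compact_Int_closed compact_cbox closed_closure)
  then have "compact (closure {x. bump m l u x \<noteq> 0})"
    using sub by (simp add: Int_absorb1)
  then show ?thesis
    unfolding test_fun_def using smooth_Ck[OF smooth_bump] sub assms(2) by blast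
qed

text \<open>The indicator of the box is a bounded pointwise limit of test functions.\<close>

lemma integral_box_eq_0:
  fixes g :: "real^'n \<Rightarrow> real"
  assumes int: "set_integrable lborel \<Omega> g" and \<Omega>: "\<Omega> \<in> sets lborel"
    and orth: "\<And>\<phi>. test_fun \<Omega> \<phi> \<Longrightarrow> (LINT x:\<Omega>|lborel. g x * \<phi> x) = 0"
    and box: "cbox l u \<subseteq> \<Omega>"
  shows "(LINT x:box l u|lborel. g x) = 0"
proof -
  let ?F = "\<lambda>m x. indicat_real \<Omega> x *\<^sub>R (g x * bump (real (Suc m)) l u x)"
  have meas: "(\<lambda>x. indicat_real \<Omega> x *\<^sub>R g x) \<in> borel_measurable lborel"
    using int unfolding set_integrable_def by (rule borel_measurable_integrable)
  have "(\<lambda>m. integral\<^sup>L lborel (?F m)) \<longlonglongrightarrow> integral\<^sup>L lborel (\<lambda>x. indicat_real (box l u) x *\<^sub>R g x)"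
  proof (rule integral_dominated_convergence)
    show "integrable lborel (\<lambda>x. norm (indicat_real \<Omega> x *\<^sub>R g x))"
      using int unfolding set_integrable_def by (rule integrable_norm)
    have "(\<lambda>x. indicat_real (box l u) x *\<^sub>R (indicat_real \<Omega> x *\<^sub>R g x)) \<in> borel_measurable lborel"
      using meas by measurable
    also have "(\<lambda>x. indicat_real (box l u) x *\<^sub>R (indicat_real \<Omega> x *\<^sub>R g x)) = (\<lambda>x. indicat_real (box l u) x *\<^sub>R g x)"
      using box box_subset_cbox by (auto simp: indicator_def fun_eq_iff)
    finally show "(\<lambda>x. indicat_real (box l u) x *\<^sub>R g x) \<in> borel_measurable lborel" .
    fix m
    have "continuous_on UNIV (bump (real (Suc m)) l u)"
      using smooth_Ck[OF smooth_bump, of 0] by simp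
    then have "bump (real (Suc m)) l u \<in> borel_measurable lborel"
      by (simp add: borel_measurable_continuous_onI)
    then have "(\<lambda>x. (indicat_real \<Omega> x *\<^sub>R g x) * bump (real (Suc m)) l u x) \<in> borel_measurable lborel"
      using meas by (rule borel_measurable_times[rotated])
    then show "?F m \<in> borel_measurable lborel"
      by (simp add: mult.assoc)
    show "AE x in lborel. norm (?F m x) \<le> norm (indicat_real \<Omega> x *\<^sub>R g x)"
      by (intro AE_I2)
        (auto simp: abs_mult abs_of_nonneg[OF bump_bounds(1)] indicator_def
          intro!: mult_left_le bump_bounds(2))
  next
    have "(\<lambda>m. ?F m x) \<longlonglongrightarrow> indicat_real (box l u) x *\<^sub>R g x" for x
    proof (cases "x \<in> box l u")
      case True
      then have "x \<in> \<Omega>" using box box_subset_cbox by blast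
      have "(\<lambda>m. g x * bump (real (Suc m)) l u x) \<longlonglongrightarrow> g x * 1"
        by (intro tendsto_mult tendsto_const bump_tendsto_1 True)
      then show ?thesis
        using True \<open>x \<in> \<Omega>\<close> by simp
    next
      case False
      then show ?thesis
        using bump_eq_0[of _ x l u] by simp
    qed
    then show "AE x in lborel. (\<lambda>m. ?F m x) \<longlonglongrightarrow> indicat_real (box l u) x *\<^sub>R g x"
      by simp
  qed
  moreover have "integral\<^sup>L lborel (?F m) = 0" for m
    using orth[OF test_fun_bump[OF _ box, of "real (Suc m)"]]
    unfolding set_lebesgue_integral_def by simp
  ultimately have "integral\<^sup>L lborel (\<lambda>x. indicat_real (box l u) x *\<^sub>R g x) = 0"
    using LIMSEQ_unique[OF _ tendsto_const] by simp
  then show ?thesis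
    unfolding set_lebesgue_integral_def .
qed

text \<open>
  Boxes are closed under intersection and generate the Borel sets, so the integral of \<open>g\<close> over
  every Borel part of \<open>box l u\<close> vanishes; the parts where \<open>g\<close> is positive or negative are then
  null sets.
\<close>

lemma AE_box_eq_0:
  fixes g :: "'a::euclidean_space \<Rightarrow> real"
  assumes int: "set_integrable lborel (box l u) g"
    and zero: "\<And>a b. cbox a b \<subseteq> cbox l u \<Longrightarrow> (LINT x:box a b|lborel. g x) = 0"
  shows "AE x in lborel. x \<in> box l u \<longrightarrow> g x = 0"
proof -
  let ?B = "box l u"
  have intA: "set_integrable lborel (A \<inter> ?B) g" if "A \<in> sets borel" for A
    by (rule set_integrable_subset[OF int]) (use that in auto)
  have Int: "Int_stable (range (\<lambda>(a, b). box a b :: 'a set))"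
    by (auto simp: Int_stable_def box_Int_box)
  have Pow: "range (\<lambda>(a, b). box a b :: 'a set) \<subseteq> Pow UNIV"
    by simp
  have sub: "(LINT x:A \<inter> ?B|lborel. g x) = 0" if A: "A \<in> sigma_sets UNIV (range (\<lambda>(a, b). box a b))" for A
    using Int Pow A
  proof (induction rule: sigma_sets_induct_disjoint[where \<Omega>=UNIV])
    fix A :: "'a set" assume "A \<in> range (\<lambda>(a, b). box a b)"
    then obtain a b where A: "A \<inter> ?B = box a b"
      by (auto simp: box_Int_box)
    show "(LINT x:A \<inter> ?B|lborel. g x) = 0"
    proof (cases "box a b = {}")
      case True
      then show ?thesis unfolding A by (simp add: set_lebesgue_integral_def)
    next
      case False
      then have "cbox a b = closure (box a b)" by (simp add: closure_box)
      also have "\<dots> \<subseteq> cbox l u"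
        using A box_subset_cbox by (intro closure_minimal closed_cbox) blast
      finally show ?thesis unfolding A by (rule zero)
    qed
  next
    fix A :: "'a set" assume A: "A \<in> sigma_sets UNIV (range (\<lambda>(a, b). box a b))"
      and IH: "(LINT x:A \<inter> ?B|lborel. g x) = 0"
    have Ab: "A \<in> sets borel" using A by (simp add: borel_eq_box)
    have "(LINT x:?B|lborel. g x) = (LINT x:(A \<inter> ?B) \<union> ((UNIV - A) \<inter> ?B)|lborel. g x)"
      by (rule arg_cong[where f="\<lambda>S. LINT x:S|lborel. g x"]) auto
    also have "\<dots> = (LINT x:A \<inter> ?B|lborel. g x) + (LINT x:(UNIV - A) \<inter> ?B|lborel. g x)"
      using Ab by (intro set_integral_Un intA) auto
    finally show "(LINT x:(UNIV - A) \<inter> ?B|lborel. g x) = 0"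
      using IH zero[of l u] by simp
  next
    fix A :: "nat \<Rightarrow> 'a set"
    assume disj: "disjoint_family A" and A: "range A \<subseteq> sigma_sets UNIV (range (\<lambda>(a, b). box a b))"
      and IH: "\<And>i. (LINT x:A i \<inter> ?B|lborel. g x) = 0"
    have Ab: "A i \<in> sets borel" for i using A by (auto simp: borel_eq_box)
    have "(LINT x:(\<Union>i. A i \<inter> ?B)|lborel. g x) = (\<Sum>i. (LINT x:A i \<inter> ?B|lborel. g x))"
    proof (rule lebesgue_integral_countable_add)
      show "A i \<inter> ?B \<in> sets lborel" for i using Ab[of i] by simp
      show "(A i \<inter> ?B) \<inter> (A j \<inter> ?B) = {}" if "i \<noteq> j" for i j
        using disj that by (auto simp: disjoint_family_on_def)
      have "set_integrable lborel ((\<Union>i. A i) \<inter> ?B) g"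
        using Ab by (intro intA) auto
      then show "set_integrable lborel (\<Union>i. A i \<inter> ?B) g" by simp
    qed
    then show "(LINT x:(\<Union>i. A i) \<inter> ?B|lborel. g x) = 0"
      using IH by simp
  qed (auto simp: set_lebesgue_integral_def)
  have meas: "(\<lambda>x. indicat_real ?B x *\<^sub>R g x) \<in> borel_measurable lborel"
    using int unfolding set_integrable_def by (rule borel_measurable_integrable)
  have half: "AE x in lborel. \<not> (x \<in> ?B \<and> 0 < c * g x)" for c
  proof -
    define A where "A = {x. 0 < c * (indicat_real ?B x *\<^sub>R g x)}"
    have A: "A \<in> sets borel"
      using meas unfolding A_def by measurable
    have AB: "A \<inter> ?B = {x. x \<in> ?B \<and> 0 < c * g x}"
      by (auto simp: A_def indicator_def split: if_splits)
    have "(\<integral>x. c * (indicat_real (A \<inter> ?B) x *\<^sub>R g x) \<partial>lborel) = 0"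
      using sub[of A] A by (simp add: borel_eq_box set_lebesgue_integral_def)
    moreover have "integrable lborel (\<lambda>x. c * (indicat_real (A \<inter> ?B) x *\<^sub>R g x))"
      using intA[OF A] unfolding set_integrable_def by (rule integrable_mult_right)
    moreover have "0 \<le> c * (indicat_real (A \<inter> ?B) x *\<^sub>R g x)" for x
      unfolding AB by (auto simp: indicator_def)
    ultimately have "AE x in lborel. c * (indicat_real (A \<inter> ?B) x *\<^sub>R g x) = 0"
      by (subst (asm) integral_nonneg_eq_0_iff_AE) auto
    then show ?thesis
      unfolding AB by eventually_elim (auto simp: indicator_def split: if_splits)
  qed
  from half[of 1] half[of "-1"] show ?thesis
    by eventually_elim auto
qed

lemma AE_cbox_imp_box: "AE x in lborel. x \<in> cbox a b \<longrightarrow> x \<in> box a b"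
proof -
  have "cbox a b - box a b \<in> null_sets (completion lborel)"
    using negligible_frontier_interval[of a b] by (simp add: negligible_iff_null_sets)
  then have "cbox a b - box a b \<in> null_sets lborel"
    by (subst (asm) null_sets_completion_iff) auto
  then have "AE x in lborel. x \<notin> cbox a b - box a b"
    by (rule AE_not_in)
  then show ?thesis
    by eventually_elim auto
qed

text \<open>
  An open set is a countable union of closed boxes, and each closed box differs from its interior
  by a null set.
\<close>

theorem fundamental_lemma_calculus_of_variations:
  fixes g :: "real^'n \<Rightarrow> real"
  assumes \<Omega>: "open \<Omega>" and int: "set_integrable lborel \<Omega> g"
    and orth: "\<And>\<phi>. test_fun \<Omega> \<phi> \<Longrightarrow> (LINT x:\<Omega>|lborel. g x * \<phi> x) = 0"
  shows "AE x in lborel. x \<in> \<Omega> \<longrightarrow> g x = 0"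
proof -
  obtain \<D> where \<D>: "countable \<D>" "\<D> \<subseteq> Pow \<Omega>" "\<And>X. X \<in> \<D> \<Longrightarrow> \<exists>a b. X = cbox a b" "\<Union>\<D> = \<Omega>"
    using open_countable_Union_open_cbox[OF \<Omega>] by metis
  have "AE x in lborel. x \<in> X \<longrightarrow> g x = 0" if X: "X \<in> \<D>" for X
  proof -
    obtain a b where ab: "X = cbox a b" using \<D>(3)[OF X] by blast
    then have sub: "cbox a b \<subseteq> \<Omega>" using \<D>(2) X by auto
    have "AE x in lborel. x \<in> box a b \<longrightarrow> g x = 0"
    proof (rule AE_box_eq_0)
      show "set_integrable lborel (box a b) g"
        by (rule set_integrable_subset[OF int]) (use sub box_subset_cbox in auto)
      show "(LINT x:box c d|lborel. g x) = 0" if "cbox c d \<subseteq> cbox a b" for c d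
        by (rule integral_box_eq_0[OF int _ orth]) (use \<Omega> that sub in auto)
    qed
    with AE_cbox_imp_box[of a b] show ?thesis
      unfolding ab by eventually_elim auto
  qed
  then have "AE x in lborel. \<forall>X\<in>\<D>. x \<in> X \<longrightarrow> g x = 0"
    unfolding AE_ball_countable[OF \<D>(1)] by blast
  then show ?thesis
    unfolding \<D>(4)[symmetric] by eventually_elim auto
qed

section \<open>Linearity of the weak divergence\<close>

lemma sq_integrable_rep_l2: "sq_integrable (rep_l2 f)"
  using l2_eq_rep_l2[of f] by (simp add: l2_eq_def)

lemma AE_rep_abs_l2:
  assumes "sq_integrable h"
  shows "AE x in lborel. rep_l2 (abs_l2 h) x = h x"
  using Quotient3_rep_abs[OF Quotient3_l2, of h] assms by (simp add: l2_eq_def)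

lemma l2_eqI:
  assumes "AE x in lborel. rep_l2 f x = rep_l2 g x"
  shows "f = g"
  using Quotient3_rel_rep[OF Quotient3_l2, of f g] assms
  by (simp add: l2_eq_def sq_integrable_rep_l2)

lemma abs_l2_add:
  assumes "sq_integrable f" "sq_integrable g"
  shows "abs_l2 (\<lambda>x. f x + g x) = abs_l2 f + abs_l2 g"
  by (rule plus_l2.abs_eq[symmetric]) (use assms in \<open>simp_all add: l2_eq_def\<close>)

lemma abs_l2_scaleR:
  assumes "sq_integrable f"
  shows "abs_l2 (\<lambda>x. c *\<^sub>R f x) = c *\<^sub>R abs_l2 f"
  by (rule scaleR_l2.abs_eq[symmetric]) (use assms in \<open>simp_all add: l2_eq_def\<close>)

lemma AE_rep_l2_add: "AE x in lborel. rep_l2 (f + g) x = rep_l2 f x + rep_l2 g x"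
  using AE_rep_abs_l2[OF sq_integrable_add[OF sq_integrable_rep_l2[of f] sq_integrable_rep_l2[of g]]]
  by (simp add: abs_l2_add sq_integrable_rep_l2 abs_rep_l2)

lemma AE_rep_l2_scaleR: "AE x in lborel. rep_l2 (c *\<^sub>R f) x = c *\<^sub>R rep_l2 f x"
  using AE_rep_abs_l2[OF sq_integrable_scaleR[OF sq_integrable_rep_l2[of f]], of c]
  by (simp add: abs_l2_scaleR sq_integrable_rep_l2 abs_rep_l2)

lemma AE_rep_l2_zero: "AE x in lborel. rep_l2 0 x = 0"
  using AE_rep_abs_l2[OF sq_integrable_zero] by (simp add: zero_l2_def)

lemma AE_rep_l2_diff: "AE x in lborel. rep_l2 (f - g) x = rep_l2 f x - rep_l2 g x"
  using AE_rep_l2_add[of f "(-1) *\<^sub>R g"] AE_rep_l2_scaleR[of "-1" g] by eventually_elim simp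

lemma inner_l2_abs:
  assumes "sq_integrable h"
  shows "f \<bullet> abs_l2 h = (\<integral>x. rep_l2 f x \<bullet> h x \<partial>lborel)"
  using inner_l2.abs_eq[of "rep_l2 f" h] assms
  by (simp add: l2_eq_def sq_integrable_rep_l2 abs_rep_l2)

lemma subspace_l2_on: "subspace (l2_on \<Omega>)"
proof (rule subspaceI)
  show "0 \<in> l2_on \<Omega>"
    unfolding l2_on_def using AE_rep_l2_zero by (auto elim: eventually_mono)
  show "f + g \<in> l2_on \<Omega>" if "f \<in> l2_on \<Omega>" "g \<in> l2_on \<Omega>" for f g :: "('a, 'b) l2"
  proof -
    from that have "AE x in lborel. x \<notin> \<Omega> \<longrightarrow> rep_l2 f x = 0" "AE x in lborel. x \<notin> \<Omega> \<longrightarrow> rep_l2 g x = 0"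
      by (simp_all add: l2_on_def)
    with AE_rep_l2_add[of f g] show ?thesis
      unfolding l2_on_def mem_Collect_eq by eventually_elim auto
  qed
  show "c *\<^sub>R f \<in> l2_on \<Omega>" if "f \<in> l2_on \<Omega>" for c and f :: "('a, 'b) l2"
  proof -
    from that have "AE x in lborel. x \<notin> \<Omega> \<longrightarrow> rep_l2 f x = 0"
      by (simp add: l2_on_def)
    with AE_rep_l2_scaleR[of c f] show ?thesis
      unfolding l2_on_def mem_Collect_eq by eventually_elim auto
  qed
qed

text \<open>
  With the class of the truncated function at hand, the integrals in the definition of the weak
  divergence are inner products (\<open>set_integral_eq_inner_cutoff\<close>), and their linearity in the class
  is immediate.
\<close>

definition cutoff :: "'a::euclidean_space set \<Rightarrow> ('a \<Rightarrow> 'b::euclidean_space) \<Rightarrow> ('a, 'b) l2" where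
  "cutoff S F = abs_l2 (\<lambda>x. indicator S x *\<^sub>R F x)"

lemma sq_integrable_cutoff:
  fixes F :: "'a::euclidean_space \<Rightarrow> 'b::euclidean_space"
  assumes S: "S \<in> sets borel" "bounded S" and F: "continuous_on UNIV F"
  shows "sq_integrable (\<lambda>x. indicator S x *\<^sub>R F x)"
proof -
  have "compact (closure S)" using S by (simp add: compact_closure)
  then have "bounded (F ` closure S)"
    by (intro compact_imp_bounded compact_continuous_image continuous_on_subset[OF F]) auto
  then obtain M where M: "\<And>x. x \<in> closure S \<Longrightarrow> norm (F x) \<le> M"
    by (auto simp: bounded_iff)
  have F': "F \<in> borel_measurable lborel"
    using borel_measurable_continuous_onI[OF F] by simp
  have "S \<in> sets lborel" using S by simp
  then have meas: "(\<lambda>x. indicator S x *\<^sub>R F x) \<in> borel_measurable lborel"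
    using F' by measurable
  then have meas2: "(\<lambda>x. (norm (indicator S x *\<^sub>R F x))\<^sup>2) \<in> borel_measurable lborel"
    by measurable
  have "integrable lborel (\<lambda>x. (norm (indicator S x *\<^sub>R F x))\<^sup>2)"
  proof (rule integrableI_bounded_set[where A=S and B="M\<^sup>2"])
    show "emeasure lborel S < \<infinity>"
      using emeasure_bounded_finite[OF S(2)] by simp
    show "AE x in lborel. x \<in> S \<longrightarrow> norm ((norm (indicator S x *\<^sub>R F x))\<^sup>2) \<le> M\<^sup>2"
      using M closure_subset[of S] by (intro AE_I2) (auto simp: indicator_def intro!: power_mono)
    show "(\<lambda>x. (norm (indicator S x *\<^sub>R F x))\<^sup>2) \<in> borel_measurable lborel"
      by (rule meas2)
  qed (use S in auto)
  then show ?thesis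
    using meas by (simp add: sq_integrable_def)
qed

lemma set_integral_eq_inner_cutoff:
  assumes "S \<in> sets borel" "bounded S" "continuous_on UNIV F"
  shows "(LINT x:S|lborel. rep_l2 f x \<bullet> F x) = f \<bullet> cutoff S F"
  unfolding cutoff_def inner_l2_abs[OF sq_integrable_cutoff[OF assms]]
  by (simp add: set_lebesgue_integral_def)

lemma set_integrable_rep_l2:
  fixes g :: "('a::euclidean_space, real) l2"
  assumes "S \<in> sets borel" "bounded S"
  shows "set_integrable lborel S (rep_l2 g)"
  using sq_integrable_inner[OF sq_integrable_rep_l2[of g] sq_integrable_cutoff[OF assms continuous_on_const, of 1]]
  by (simp add: set_integrable_def mult.commute)

lemma GDERIV_unique:
  assumes "GDERIV f x :> D" "GDERIV f x :> D'"
  shows "D = D'"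
proof -
  have "(\<lambda>h. h \<bullet> D) = (\<lambda>h. h \<bullet> D')"
    using assms unfolding gderiv_def by (rule has_derivative_unique)
  then have "(D - D') \<bullet> D = (D - D') \<bullet> D'"
    by (rule fun_cong)
  then have "(D - D') \<bullet> (D - D') = 0"
    by (simp add: inner_diff_right)
  then show ?thesis by simp
qed

lemma test_fun_continuous: "test_fun \<Omega> \<phi> \<Longrightarrow> continuous_on UNIV \<phi>"
  unfolding test_fun_def by (metis Ck.simps(1))

lemma test_fun_gradient:
  assumes "test_fun \<Omega> \<phi>"
  obtains G where "\<And>x. GDERIV \<phi> x :> G x" "continuous_on UNIV G"
proof -
  have "Ck (Suc 0) \<phi>" using assms by (simp only: test_fun_def)
  then obtain G where G: "\<forall>x. GDERIV \<phi> x :> G x" "\<forall>i. continuous_on UNIV (\<lambda>x. G x $ i)"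
    by auto
  have "continuous_on UNIV (\<lambda>x. \<chi> i. G x $ i)"
    using G(2) by (intro continuous_on_vec_lambda) auto
  then show ?thesis
    using that[of G] G(1) by simp
qed

context
  fixes \<Omega> :: "(real^'n) set"
  assumes \<Omega>: "open \<Omega>" "bounded \<Omega>"
begin

lemma is_weak_div_iff_inner:
  "is_weak_div \<Omega> \<sigma> g \<longleftrightarrow> g \<in> l2_on \<Omega> \<and>
     (\<forall>\<phi> G. test_fun \<Omega> \<phi> \<longrightarrow> (\<forall>x. GDERIV \<phi> x :> G x) \<longrightarrow>
        g \<bullet> cutoff \<Omega> \<phi> = - (\<sigma> \<bullet> cutoff \<Omega> G))"
proof -
  have "(LINT x:\<Omega>|lborel. rep_l2 g x * \<phi> x) = g \<bullet> cutoff \<Omega> \<phi> \<and>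
      (LINT x:\<Omega>|lborel. rep_l2 \<sigma> x \<bullet> G x) = \<sigma> \<bullet> cutoff \<Omega> G"
    if \<phi>: "test_fun \<Omega> \<phi>" and G: "\<forall>x. GDERIV \<phi> x :> G x" for \<phi> G
  proof -
    \<comment> \<open>gradients are unique, so the given one inherits continuity from the definition of \<open>Ck\<close>\<close>
    obtain G' where "\<And>x. GDERIV \<phi> x :> G' x" "continuous_on UNIV G'"
      using test_fun_gradient[OF \<phi>] by blast
    then have "continuous_on UNIV G"
      using GDERIV_unique G by (metis continuous_on_cong)
    then show ?thesis
      using set_integral_eq_inner_cutoff[of \<Omega> \<phi> g] set_integral_eq_inner_cutoff[of \<Omega> G \<sigma>]
        test_fun_continuous[OF \<phi>] \<Omega> by simp
  qed
  then show ?thesis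
    unfolding is_weak_div_def by (auto simp del: gderiv_deriv)
qed

lemma is_weak_div_add:
  assumes "is_weak_div \<Omega> \<sigma> g" "is_weak_div \<Omega> \<tau> h"
  shows "is_weak_div \<Omega> (\<sigma> + \<tau>) (g + h)"
  using assms unfolding is_weak_div_iff_inner
  by (simp add: subspace_add[OF subspace_l2_on] inner_add_left)

lemma is_weak_div_scaleR:
  assumes "is_weak_div \<Omega> \<sigma> g"
  shows "is_weak_div \<Omega> (c *\<^sub>R \<sigma>) (c *\<^sub>R g)"
  using assms unfolding is_weak_div_iff_inner
  by (simp add: subspace_scale[OF subspace_l2_on])

text \<open>
  The difference \<open>d\<close> of two weak divergences of the same field is orthogonal to all test
  functions on \<open>\<Omega>\<close>.
\<close>

lemma is_weak_div_unique:
  assumes g: "is_weak_div \<Omega> \<sigma> g" and h: "is_weak_div \<Omega> \<sigma> h"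
  shows "g = h"
proof -
  define d where "d = g + (-1) *\<^sub>R h"
  have "is_weak_div \<Omega> (\<sigma> + (-1) *\<^sub>R \<sigma>) d"
    unfolding d_def by (intro is_weak_div_add is_weak_div_scaleR g h)
  then have d: "d \<in> l2_on \<Omega>"
    "\<And>\<phi> G. test_fun \<Omega> \<phi> \<Longrightarrow> (\<forall>x. GDERIV \<phi> x :> G x) \<Longrightarrow> d \<bullet> cutoff \<Omega> \<phi> = 0"
    unfolding is_weak_div_iff_inner by auto
  have "AE x in lborel. x \<in> \<Omega> \<longrightarrow> rep_l2 d x = 0"
  proof (rule fundamental_lemma_calculus_of_variations[OF \<Omega>(1)])
    show "set_integrable lborel \<Omega> (rep_l2 d)"
      using \<Omega> by (intro set_integrable_rep_l2) auto
    fix \<phi> assume \<phi>: "test_fun \<Omega> \<phi>"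
    obtain G where "\<And>x. GDERIV \<phi> x :> G x"
      using test_fun_gradient[OF \<phi>] by blast
    then have "d \<bullet> cutoff \<Omega> \<phi> = 0" using d(2)[OF \<phi>] by blast
    then show "(LINT x:\<Omega>|lborel. rep_l2 d x * \<phi> x) = 0"
      using set_integral_eq_inner_cutoff[of \<Omega> \<phi> d] test_fun_continuous[OF \<phi>] \<Omega> by simp
  qed
  moreover have "AE x in lborel. x \<notin> \<Omega> \<longrightarrow> rep_l2 d x = 0"
    using d(1) by (simp add: l2_on_def)
  ultimately have "AE x in lborel. rep_l2 d x = rep_l2 0 x"
    using AE_rep_l2_zero by eventually_elim auto
  then have "d = 0" by (rule l2_eqI)
  then show ?thesis by (simp add: d_def)
qed

lemma weak_div_eq: "is_weak_div \<Omega> \<sigma> g \<Longrightarrow> weak_div \<Omega> \<sigma> = g"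
  unfolding weak_div_def by (rule the_equality) (auto intro: is_weak_div_unique)

lemma is_weak_div_weak_div: "\<sigma> \<in> H_div \<Omega> \<Longrightarrow> is_weak_div \<Omega> \<sigma> (weak_div \<Omega> \<sigma>)"
  using weak_div_eq by (auto simp: H_div_def)

lemma subspace_H_div: "subspace (H_div \<Omega>)"
proof (rule subspaceI)
  have "is_weak_div \<Omega> 0 0"
    unfolding is_weak_div_iff_inner by (simp add: subspace_0[OF subspace_l2_on])
  then show "0 \<in> H_div \<Omega>"
    using subspace_0[OF subspace_l2_on] by (auto simp: H_div_def)
  show "\<sigma> + \<tau> \<in> H_div \<Omega>" if "\<sigma> \<in> H_div \<Omega>" "\<tau> \<in> H_div \<Omega>" for \<sigma> \<tau>
    using that is_weak_div_add subspace_add[OF subspace_l2_on] unfolding H_div_def by blast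
  show "c *\<^sub>R \<sigma> \<in> H_div \<Omega>" if "\<sigma> \<in> H_div \<Omega>" for c \<sigma>
    using that is_weak_div_scaleR subspace_scale[OF subspace_l2_on] unfolding H_div_def by blast
qed

lemma weak_div_add:
  "\<sigma> \<in> H_div \<Omega> \<Longrightarrow> \<tau> \<in> H_div \<Omega> \<Longrightarrow> weak_div \<Omega> (\<sigma> + \<tau>) = weak_div \<Omega> \<sigma> + weak_div \<Omega> \<tau>"
  by (intro weak_div_eq is_weak_div_add is_weak_div_weak_div)

lemma weak_div_scaleR: "\<sigma> \<in> H_div \<Omega> \<Longrightarrow> weak_div \<Omega> (c *\<^sub>R \<sigma>) = c *\<^sub>R weak_div \<Omega> \<sigma>"
  by (intro weak_div_eq is_weak_div_scaleR is_weak_div_weak_div)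

end

section \<open>Raviart-Thomas spaces are nested and finite-dimensional\<close>

lemma cutoff_add:
  fixes F G :: "'a::euclidean_space \<Rightarrow> 'b::euclidean_space"
  assumes S: "S \<in> sets borel" "bounded S" and F: "continuous_on UNIV F" and G: "continuous_on UNIV G"
  shows "cutoff S (\<lambda>x. F x + G x) = cutoff S F + cutoff S G"
  unfolding cutoff_def scaleR_add_right
  by (rule abs_l2_add[OF sq_integrable_cutoff[OF S F] sq_integrable_cutoff[OF S G]])

lemma cutoff_scaleR:
  fixes F :: "'a::euclidean_space \<Rightarrow> 'b::euclidean_space"
  assumes S: "S \<in> sets borel" "bounded S" and F: "continuous_on UNIV F"
  shows "cutoff S (\<lambda>x. c *\<^sub>R F x) = c *\<^sub>R cutoff S F"
  unfolding cutoff_def scaleR_left_commute[of _ c]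
  by (rule abs_l2_scaleR[OF sq_integrable_cutoff[OF S F]])

lemma AE_cutoff:
  fixes F :: "'a::euclidean_space \<Rightarrow> 'b::euclidean_space"
  assumes S: "S \<in> sets borel" "bounded S" and F: "continuous_on UNIV F"
  shows "AE x in lborel. rep_l2 (cutoff S F) x = indicator S x *\<^sub>R F x"
  unfolding cutoff_def by (rule AE_rep_abs_l2[OF sq_integrable_cutoff[OF S F]])

lemma cutoff_sum:
  fixes F :: "'i \<Rightarrow> 'a::euclidean_space \<Rightarrow> 'b::euclidean_space"
  assumes S: "S \<in> sets borel" "bounded S" and "finite I" and "\<And>i. i \<in> I \<Longrightarrow> continuous_on UNIV (F i)"
  shows "cutoff S (\<lambda>x. \<Sum>i\<in>I. c i *\<^sub>R F i x) = (\<Sum>i\<in>I. c i *\<^sub>R cutoff S (F i))"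
  using assms(3,4)
proof (induction I rule: finite_induct)
  case empty
  have "cutoff S (\<lambda>x. 0 *\<^sub>R (0::'b)) = (0 *\<^sub>R cutoff S (\<lambda>x. 0) :: ('a, 'b) l2)"
    by (rule cutoff_scaleR[OF S continuous_on_const])
  then show ?case by simp
next
  case (insert i I)
  then show ?case
    by (simp add: cutoff_add[OF S] cutoff_scaleR[OF S] continuous_on_sum continuous_on_scaleR)
qed

definition multi_power :: "('n \<Rightarrow> nat) \<Rightarrow> real^'n \<Rightarrow> real" where
  "multi_power \<alpha> x = (\<Prod>i\<in>UNIV. (x $ i) ^ \<alpha> i)"

definition multi_indices :: "nat \<Rightarrow> ('n::finite \<Rightarrow> nat) set" where
  "multi_indices r = {\<alpha>. (\<Sum>i\<in>UNIV. \<alpha> i) \<le> r}"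

lemma finite_multi_indices: "finite (multi_indices r :: ('n::finite \<Rightarrow> nat) set)"
proof (rule finite_subset)
  show "multi_indices r \<subseteq> PiE (UNIV :: 'n set) (\<lambda>_. {..r})"
  proof
    fix \<alpha> :: "'n \<Rightarrow> nat" assume "\<alpha> \<in> multi_indices r"
    then have "\<alpha> i \<le> r" for i
      using member_le_sum[of i UNIV \<alpha>] by (force simp: multi_indices_def)
    then show "\<alpha> \<in> PiE UNIV (\<lambda>_. {..r})" by auto
  qed
qed (auto intro: finite_PiE)

lemma continuous_multi_power: "continuous_on UNIV (multi_power \<alpha>)"
  unfolding multi_power_def[abs_def] by (intro continuous_intros)

lemma polys_iff: "p \<in> polys r \<longleftrightarrow> (\<exists>c. p = (\<lambda>x. \<Sum>\<alpha>\<in>multi_indices r. c \<alpha> * multi_power \<alpha> x))"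
  by (simp add: polys_def multi_power_def multi_indices_def)

lemma polys_add: "p \<in> polys r \<Longrightarrow> q \<in> polys r \<Longrightarrow> (\<lambda>x. p x + q x) \<in> polys r"
  unfolding polys_iff
proof (elim exE)
  fix c d assume *: "p = (\<lambda>x. \<Sum>\<alpha>\<in>multi_indices r. c \<alpha> * multi_power \<alpha> x)" "q = (\<lambda>x. \<Sum>\<alpha>\<in>multi_indices r. d \<alpha> * multi_power \<alpha> x)"
  show "\<exists>e. (\<lambda>x. p x + q x) = (\<lambda>x. \<Sum>\<alpha>\<in>multi_indices r. e \<alpha> * multi_power \<alpha> x)"
    by (rule exI[of _ "\<lambda>\<alpha>. c \<alpha> + d \<alpha>"]) (simp add: * distrib_right sum.distrib)
qed

lemma polys_scale: "p \<in> polys r \<Longrightarrow> (\<lambda>x. a * p x) \<in> polys r"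
  unfolding polys_iff
proof (elim exE)
  fix c assume *: "p = (\<lambda>x. \<Sum>\<alpha>\<in>multi_indices r. c \<alpha> * multi_power \<alpha> x)"
  show "\<exists>e. (\<lambda>x. a * p x) = (\<lambda>x. \<Sum>\<alpha>\<in>multi_indices r. e \<alpha> * multi_power \<alpha> x)"
    by (rule exI[of _ "\<lambda>\<alpha>. a * c \<alpha>"]) (simp add: * sum_distrib_left mult.assoc)
qed

lemma RT_shape_add: "v \<in> RT_shape r \<Longrightarrow> w \<in> RT_shape r \<Longrightarrow> (\<lambda>x. v x + w x) \<in> RT_shape r"
  unfolding RT_shape_def mem_Collect_eq
proof (elim exE conjE)
  fix p q p' q'
  assume *: "\<forall>i. (\<lambda>x. p x $ i) \<in> polys r" "q \<in> polys r" "v = (\<lambda>x. p x + q x *\<^sub>R x)"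
    "\<forall>i. (\<lambda>x. p' x $ i) \<in> polys r" "q' \<in> polys r" "w = (\<lambda>x. p' x + q' x *\<^sub>R x)"
  show "\<exists>p'' q''. (\<forall>i. (\<lambda>x. p'' x $ i) \<in> polys r) \<and> q'' \<in> polys r \<and>
      (\<lambda>x. v x + w x) = (\<lambda>x. p'' x + q'' x *\<^sub>R x)"
    by (rule exI[of _ "\<lambda>x. p x + p' x"], rule exI[of _ "\<lambda>x. q x + q' x"])
      (use * in \<open>auto simp: scaleR_add_left intro!: polys_add\<close>)
qed

lemma RT_shape_scaleR: "v \<in> RT_shape r \<Longrightarrow> (\<lambda>x. a *\<^sub>R v x) \<in> RT_shape r"
  unfolding RT_shape_def mem_Collect_eq
proof (elim exE conjE)
  fix p q
  assume *: "\<forall>i. (\<lambda>x. p x $ i) \<in> polys r" "q \<in> polys r" "v = (\<lambda>x. p x + q x *\<^sub>R x)"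
  show "\<exists>p' q'. (\<forall>i. (\<lambda>x. p' x $ i) \<in> polys r) \<and> q' \<in> polys r \<and>
      (\<lambda>x. a *\<^sub>R v x) = (\<lambda>x. p' x + q' x *\<^sub>R x)"
    by (rule exI[of _ "\<lambda>x. a *\<^sub>R p x"], rule exI[of _ "\<lambda>x. a * q x"])
      (use * in \<open>auto simp: scaleR_add_right intro!: polys_scale\<close>)
qed

text \<open>
  The shape functions are combinations of the finitely many fields $x^\alpha e_i$ and $x^\alpha x$
  with $|\alpha| \le r$.
\<close>

lemma RT_shape_expansion:
  fixes v :: "real^'n \<Rightarrow> real^'n"
  assumes "v \<in> RT_shape r"
  obtains c d where "v = (\<lambda>x. (\<Sum>(\<alpha>, i)\<in>multi_indices r \<times> UNIV. c \<alpha> i *\<^sub>R (multi_power \<alpha> x *\<^sub>R axis i 1))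
      + (\<Sum>\<alpha>\<in>multi_indices r. d \<alpha> *\<^sub>R (multi_power \<alpha> x *\<^sub>R x)))"
proof -
  obtain p q where p: "\<forall>i. (\<lambda>x. p x $ i) \<in> polys r" and q: "q \<in> polys r"
    and v: "v = (\<lambda>x. p x + q x *\<^sub>R x)"
    using assms by (auto simp: RT_shape_def)
  obtain d where d: "q = (\<lambda>x. \<Sum>\<alpha>\<in>multi_indices r. d \<alpha> * multi_power \<alpha> x)"
    using q by (auto simp: polys_iff)
  have "\<forall>i. \<exists>c. (\<lambda>x. p x $ i) = (\<lambda>x. \<Sum>\<alpha>\<in>multi_indices r. c \<alpha> * multi_power \<alpha> x)"
    using p by (simp add: polys_iff)
  then obtain c where c: "\<And>i. (\<lambda>x. p x $ i) = (\<lambda>x. \<Sum>\<alpha>\<in>multi_indices r. c i \<alpha> * multi_power \<alpha> x)"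
    by metis
  have "p x = (\<Sum>(\<alpha>, i)\<in>multi_indices r \<times> UNIV. c i \<alpha> *\<^sub>R (multi_power \<alpha> x *\<^sub>R axis i 1))" for x
  proof -
    have "p x = (\<Sum>i\<in>UNIV. (p x $ i) *\<^sub>R axis i 1)"
      using basis_expansion[of "p x"] by (simp add: scalar_mult_eq_scaleR)
    also have "\<dots> = (\<Sum>i\<in>UNIV. \<Sum>\<alpha>\<in>multi_indices r. c i \<alpha> *\<^sub>R (multi_power \<alpha> x *\<^sub>R axis i 1))"
      using fun_cong[OF c] by (simp add: scaleR_sum_left)
    also have "\<dots> = (\<Sum>(\<alpha>, i)\<in>multi_indices r \<times> UNIV. c i \<alpha> *\<^sub>R (multi_power \<alpha> x *\<^sub>R axis i 1))"
      by (subst sum.swap) (simp add: sum.cartesian_product)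
    finally show ?thesis .
  qed
  then have "v = (\<lambda>x. (\<Sum>(\<alpha>, i)\<in>multi_indices r \<times> UNIV. c i \<alpha> *\<^sub>R (multi_power \<alpha> x *\<^sub>R axis i 1))
      + (\<Sum>\<alpha>\<in>multi_indices r. d \<alpha> *\<^sub>R (multi_power \<alpha> x *\<^sub>R x)))"
    unfolding v d by (simp add: scaleR_sum_left)
  then show ?thesis by (rule that)
qed

lemma RT_shape_continuous:
  assumes "v \<in> RT_shape r"
  shows "continuous_on UNIV v"
proof -
  obtain c d where "v = (\<lambda>x. (\<Sum>(\<alpha>, i)\<in>multi_indices r \<times> UNIV. c \<alpha> i *\<^sub>R (multi_power \<alpha> x *\<^sub>R axis i 1))
      + (\<Sum>\<alpha>\<in>multi_indices r. d \<alpha> *\<^sub>R (multi_power \<alpha> x *\<^sub>R x)))"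
    using RT_shape_expansion[OF assms] .
  then show ?thesis
    by (simp add: split_def) (intro continuous_intros continuous_multi_power)
qed

lemma RT_shape_cutoff_finite_dim:
  fixes S :: "(real^'n) set"
  assumes S: "S \<in> sets borel" "bounded S"
  obtains B where "finite B" "\<And>v. v \<in> RT_shape r \<Longrightarrow> cutoff S v \<in> span B"
proof -
  let ?M = "multi_indices r :: ('n \<Rightarrow> nat) set"
  let ?b = "\<lambda>(\<alpha>, i). cutoff S (\<lambda>x. multi_power \<alpha> x *\<^sub>R axis i 1) :: (real^'n, real^'n) l2"
  let ?b' = "\<lambda>\<alpha>. cutoff S (\<lambda>x. multi_power \<alpha> x *\<^sub>R x) :: (real^'n, real^'n) l2"
  define B where "B = ?b ` (?M \<times> UNIV) \<union> ?b' ` ?M"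
  have "finite B"
    unfolding B_def by (simp add: finite_multi_indices)
  moreover have "cutoff S v \<in> span B" if v: "v \<in> RT_shape r" for v
  proof -
    obtain c d where v_eq: "v = (\<lambda>x. (\<Sum>(\<alpha>, i)\<in>?M \<times> UNIV. c \<alpha> i *\<^sub>R (multi_power \<alpha> x *\<^sub>R axis i 1))
        + (\<Sum>\<alpha>\<in>?M. d \<alpha> *\<^sub>R (multi_power \<alpha> x *\<^sub>R x)))"
      using RT_shape_expansion[OF v] .
    let ?v1 = "\<lambda>x. \<Sum>p\<in>?M \<times> UNIV. c (fst p) (snd p) *\<^sub>R (multi_power (fst p) x *\<^sub>R axis (snd p) 1)"
    let ?v2 = "\<lambda>x. \<Sum>\<alpha>\<in>?M. d \<alpha> *\<^sub>R (multi_power \<alpha> x *\<^sub>R x)"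
    have "cutoff S v = cutoff S ?v1 + cutoff S ?v2"
      unfolding v_eq split_def by (intro cutoff_add[OF S] continuous_intros continuous_multi_power)
    also have "cutoff S ?v1 = (\<Sum>p\<in>?M \<times> UNIV. c (fst p) (snd p) *\<^sub>R ?b p)"
      unfolding split_def
      by (intro cutoff_sum[OF S] continuous_intros continuous_multi_power)
        (auto simp: finite_multi_indices)
    also have "cutoff S ?v2 = (\<Sum>\<alpha>\<in>?M. d \<alpha> *\<^sub>R ?b' \<alpha>)"
      by (intro cutoff_sum[OF S] continuous_intros continuous_multi_power finite_multi_indices)
    finally have "cutoff S v = (\<Sum>p\<in>?M \<times> UNIV. c (fst p) (snd p) *\<^sub>R ?b p) + (\<Sum>\<alpha>\<in>?M. d \<alpha> *\<^sub>R ?b' \<alpha>)" .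
    moreover have "?b p \<in> B" if "p \<in> ?M \<times> UNIV" for p
      unfolding B_def using that by blast
    moreover have "?b' \<alpha> \<in> B" if "\<alpha> \<in> ?M" for \<alpha>
      unfolding B_def using that by blast
    ultimately show ?thesis
      by (simp only:) (intro span_add span_sum span_scale span_base)
  qed
  ultimately show ?thesis by (rule that)
qed

text \<open>
  Simplices of a triangulation share faces, so the members of the space are cut into disjoint pieces
  by peeling off one simplex at a time. To make this an induction, the statement carries a set \<open>E\<close>
  outside of which everything vanishes: subtracting the shape function of \<open>K\<close>, truncated to \<open>K \<inter> E\<close>, leaves a member of
  the space for the remaining simplices and \<open>E - K\<close>.
\<close>

lemma piecewise_RT_shape_finite_dim:
  fixes \<T> :: "(real^'n) set set"
  assumes "finite \<T>" "\<And>K. K \<in> \<T> \<Longrightarrow> K \<in> sets borel" and E: "E \<in> sets borel" "bounded E"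
  shows "\<exists>B. finite B \<and> {\<tau>. (AE x in lborel. x \<notin> E \<inter> \<Union>\<T> \<longrightarrow> rep_l2 \<tau> x = 0) \<and>
    (\<forall>K\<in>\<T>. \<exists>v\<in>RT_shape r. AE x in lborel. x \<in> K \<inter> E \<longrightarrow> rep_l2 \<tau> x = v x)} \<subseteq> span B"
  using assms
proof (induction \<T> arbitrary: E rule: finite_induct)
  case empty
  have "\<tau> = 0" if "AE x in lborel. rep_l2 \<tau> x = 0" for \<tau> :: "(real^'n, real^'n) l2"
  proof (rule l2_eqI)
    show "AE x in lborel. rep_l2 \<tau> x = rep_l2 0 x"
      using that AE_rep_l2_zero by eventually_elim simp
  qed
  then show ?case
    by (intro exI[of _ "{}"]) auto
next
  case (insert K \<T>)
  have K: "K \<in> sets borel" using insert.prems by simp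
  have KE: "K \<inter> E \<in> sets borel" "bounded (K \<inter> E)"
    using K insert.prems by (auto intro: bounded_subset)
  have EK: "E - K \<in> sets borel" "bounded (E - K)"
    using K insert.prems by (auto intro: bounded_subset)
  obtain B0 :: "(real^'n, real^'n) l2 set" where
    B0: "finite B0" "\<And>v. v \<in> RT_shape r \<Longrightarrow> cutoff (K \<inter> E) v \<in> span B0"
    by (rule RT_shape_cutoff_finite_dim[where r=r, OF KE]) blast
  obtain B1 :: "(real^'n, real^'n) l2 set" where B1: "finite B1"
    "\<And>\<tau>. (AE x in lborel. x \<notin> (E - K) \<inter> \<Union>\<T> \<longrightarrow> rep_l2 \<tau> x = 0) \<Longrightarrow>
      (\<forall>K'\<in>\<T>. \<exists>v\<in>RT_shape r. AE x in lborel. x \<in> K' \<inter> (E - K) \<longrightarrow> rep_l2 \<tau> x = v x) \<Longrightarrow> \<tau> \<in> span B1"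
    using insert.IH[OF _ EK] insert.prems(1) by blast
  have "\<tau> \<in> span (B0 \<union> B1)"
    if off: "AE x in lborel. x \<notin> E \<inter> \<Union>(insert K \<T>) \<longrightarrow> rep_l2 \<tau> x = 0"
      and on: "\<forall>K'\<in>insert K \<T>. \<exists>v\<in>RT_shape r. AE x in lborel. x \<in> K' \<inter> E \<longrightarrow> rep_l2 \<tau> x = v x"
    for \<tau>
  proof -
    obtain v where v: "v \<in> RT_shape r" and \<tau>v: "AE x in lborel. x \<in> K \<inter> E \<longrightarrow> rep_l2 \<tau> x = v x"
      using on by blast
    define \<rho> where "\<rho> = \<tau> - cutoff (K \<inter> E) v"
    have \<rho>: "AE x in lborel. rep_l2 \<rho> x = rep_l2 \<tau> x - indicator (K \<inter> E) x *\<^sub>R v x"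
      using AE_rep_l2_diff[of \<tau> "cutoff (K \<inter> E) v"] AE_cutoff[OF KE RT_shape_continuous[OF v]]
      unfolding \<rho>_def by eventually_elim simp
    have "\<rho> \<in> span B1"
    proof (rule B1(2))
      show "AE x in lborel. x \<notin> (E - K) \<inter> \<Union>\<T> \<longrightarrow> rep_l2 \<rho> x = 0"
        using \<rho> \<tau>v off by eventually_elim (auto simp: indicator_def)
      show "\<forall>K'\<in>\<T>. \<exists>w\<in>RT_shape r. AE x in lborel. x \<in> K' \<inter> (E - K) \<longrightarrow> rep_l2 \<rho> x = w x"
      proof
        fix K' assume "K' \<in> \<T>"
        then obtain w where w: "w \<in> RT_shape r" "AE x in lborel. x \<in> K' \<inter> E \<longrightarrow> rep_l2 \<tau> x = w x"
          using on by blast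
        have "AE x in lborel. x \<in> K' \<inter> (E - K) \<longrightarrow> rep_l2 \<rho> x = w x"
          using \<rho> w(2) by eventually_elim (auto simp: indicator_def)
        then show "\<exists>w\<in>RT_shape r. AE x in lborel. x \<in> K' \<inter> (E - K) \<longrightarrow> rep_l2 \<rho> x = w x"
          using w(1) by blast
      qed
    qed
    then have "\<rho> \<in> span (B0 \<union> B1)"
      using span_mono[of B1 "B0 \<union> B1"] by auto
    moreover have "cutoff (K \<inter> E) v \<in> span (B0 \<union> B1)"
      using B0(2)[OF v] span_mono[of B0 "B0 \<union> B1"] by auto
    moreover have "\<tau> = \<rho> + cutoff (K \<inter> E) v"
      by (simp add: \<rho>_def)
    ultimately show ?thesis
      by (metis span_add)
  qed
  then show ?case
    using B0(1) B1(1) by (intro exI[of _ "B0 \<union> B1"]) blast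
qed

lemma RT_spaceE:
  assumes "\<tau> \<in> RT_space \<Omega> r \<T>" "K \<in> \<T>"
  obtains v where "v \<in> RT_shape r" "AE x in lborel. x \<in> K \<longrightarrow> rep_l2 \<tau> x = v x"
  using assms by (auto simp: RT_space_def)

lemma RT_spaceI:
  assumes "\<tau> \<in> H_div \<Omega>"
    and "\<And>K. K \<in> \<T> \<Longrightarrow> \<exists>v\<in>RT_shape r. AE x in lborel. x \<in> K \<longrightarrow> rep_l2 \<tau> x = v x"
  shows "\<tau> \<in> RT_space \<Omega> r \<T>"
  using assms by (auto simp: RT_space_def)

lemma RT_space_subset_H_div: "RT_space \<Omega> r \<T> \<subseteq> H_div \<Omega>"
  by (auto simp: RT_space_def)

lemma subspace_RT_space:
  fixes \<Omega> :: "(real^'n) set"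
  assumes "open \<Omega>" "bounded \<Omega>"
  shows "subspace (RT_space \<Omega> r \<T>)"
proof (rule subspaceI)
  note H = subspace_H_div[OF assms]
  have "(\<lambda>x. 0) \<in> (polys r :: (real^'n \<Rightarrow> real) set)"
    unfolding polys_iff by (rule exI[of _ "\<lambda>_. 0"]) simp
  then have "(\<lambda>x. 0 + 0 *\<^sub>R x) \<in> (RT_shape r :: (real^'n \<Rightarrow> real^'n) set)"
    unfolding RT_shape_def mem_Collect_eq by (intro exI[of _ "\<lambda>x. 0"] conjI) auto
  then have zero: "(\<lambda>x. 0) \<in> (RT_shape r :: (real^'n \<Rightarrow> real^'n) set)" by simp
  show "0 \<in> RT_space \<Omega> r \<T>"
  proof (rule RT_spaceI[OF subspace_0[OF H]])
    fix K :: "(real^'n) set"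
    have "AE x in lborel. x \<in> K \<longrightarrow> rep_l2 (0 :: (real^'n, real^'n) l2) x = 0"
      by (rule eventually_mono[OF AE_rep_l2_zero[where 'a="real^'n" and 'b="real^'n"]]) simp
    then show "\<exists>v\<in>RT_shape r. AE x in lborel. x \<in> K \<longrightarrow> rep_l2 (0 :: (real^'n, real^'n) l2) x = v x"
      by (rule bexI[where x="\<lambda>x. 0", OF _ zero])
  qed
  show "\<sigma> + \<tau> \<in> RT_space \<Omega> r \<T>" if \<sigma>: "\<sigma> \<in> RT_space \<Omega> r \<T>" and \<tau>: "\<tau> \<in> RT_space \<Omega> r \<T>" for \<sigma> \<tau>
  proof (rule RT_spaceI)
    show "\<sigma> + \<tau> \<in> H_div \<Omega>"
      using \<sigma> \<tau> RT_space_subset_H_div by (intro subspace_add[OF H]) auto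
    fix K assume K: "K \<in> \<T>"
    obtain v where v: "v \<in> RT_shape r" "AE x in lborel. x \<in> K \<longrightarrow> rep_l2 \<sigma> x = v x"
      using RT_spaceE[OF \<sigma> K] .
    obtain w where w: "w \<in> RT_shape r" "AE x in lborel. x \<in> K \<longrightarrow> rep_l2 \<tau> x = w x"
      using RT_spaceE[OF \<tau> K] .
    have "AE x in lborel. x \<in> K \<longrightarrow> rep_l2 (\<sigma> + \<tau>) x = v x + w x"
      using v(2) w(2) AE_rep_l2_add[of \<sigma> \<tau>] by eventually_elim auto
    then show "\<exists>v\<in>RT_shape r. AE x in lborel. x \<in> K \<longrightarrow> rep_l2 (\<sigma> + \<tau>) x = v x"
      by (rule bexI[OF _ RT_shape_add[OF v(1) w(1)]])
  qed
  show "c *\<^sub>R \<sigma> \<in> RT_space \<Omega> r \<T>" if \<sigma>: "\<sigma> \<in> RT_space \<Omega> r \<T>" for c \<sigma>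
  proof (rule RT_spaceI)
    show "c *\<^sub>R \<sigma> \<in> H_div \<Omega>"
      using \<sigma> RT_space_subset_H_div by (intro subspace_scale[OF H]) auto
    fix K assume K: "K \<in> \<T>"
    obtain v where v: "v \<in> RT_shape r" "AE x in lborel. x \<in> K \<longrightarrow> rep_l2 \<sigma> x = v x"
      using RT_spaceE[OF \<sigma> K] .
    have "AE x in lborel. x \<in> K \<longrightarrow> rep_l2 (c *\<^sub>R \<sigma>) x = c *\<^sub>R v x"
      using v(2) AE_rep_l2_scaleR[of c \<sigma>] by eventually_elim auto
    then show "\<exists>v\<in>RT_shape r. AE x in lborel. x \<in> K \<longrightarrow> rep_l2 (c *\<^sub>R \<sigma>) x = v x"
      by (rule bexI[OF _ RT_shape_scaleR[OF v(1)]])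
  qed
qed

lemma RT_space_finite_dim:
  fixes \<Omega> :: "(real^'n) set"
  assumes \<Omega>: "open \<Omega>" "bounded \<Omega>" and \<T>: "triangulation_of \<Omega> \<T>"
  shows "finite_dim_subspace (RT_space \<Omega> r \<T>)"
proof -
  have "finite \<T>" and simplex: "\<And>K. K \<in> \<T> \<Longrightarrow> int CARD('n) simplex K" and union: "\<Union>\<T> = closure \<Omega>"
    using \<T> by (auto simp: triangulation_of_def triangulation_def)
  moreover have "K \<in> sets borel" if "K \<in> \<T>" for K
    using closed_simplex[OF simplex[OF that]] by (rule borel_closed)
  ultimately obtain B :: "(real^'n, real^'n) l2 set" where B: "finite B"
    "{\<tau>. (AE x in lborel. x \<notin> \<Omega> \<inter> \<Union>\<T> \<longrightarrow> rep_l2 \<tau> x = 0) \<and>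
      (\<forall>K\<in>\<T>. \<exists>v\<in>RT_shape r. AE x in lborel. x \<in> K \<inter> \<Omega> \<longrightarrow> rep_l2 \<tau> x = v x)} \<subseteq> span B"
    using piecewise_RT_shape_finite_dim[of \<T> \<Omega> r] \<Omega> by auto
  have "\<Omega> \<inter> \<Union>\<T> = \<Omega>"
    using union closure_subset by auto
  have "RT_space \<Omega> r \<T> \<subseteq> span B"
  proof
    fix \<tau> assume \<tau>: "\<tau> \<in> RT_space \<Omega> r \<T>"
    have "\<exists>v\<in>RT_shape r. AE x in lborel. x \<in> K \<inter> \<Omega> \<longrightarrow> rep_l2 \<tau> x = v x" if "K \<in> \<T>" for K
    proof -
      obtain v where v: "v \<in> RT_shape r" "AE x in lborel. x \<in> K \<longrightarrow> rep_l2 \<tau> x = v x"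
        using RT_spaceE[OF \<tau> \<open>K \<in> \<T>\<close>] .
      from v(2) have "AE x in lborel. x \<in> K \<inter> \<Omega> \<longrightarrow> rep_l2 \<tau> x = v x"
        by eventually_elim auto
      then show ?thesis using v(1) by blast
    qed
    moreover have "AE x in lborel. x \<notin> \<Omega> \<longrightarrow> rep_l2 \<tau> x = 0"
      using \<tau> by (simp add: RT_space_def H_div_def l2_on_def)
    ultimately show "\<tau> \<in> span B"
      using B(2) \<open>\<Omega> \<inter> \<Union>\<T> = \<Omega>\<close> by auto
  qed
  then show ?thesis
    using subspace_RT_space[OF \<Omega>] B(1) by (rule finite_dim_subspaceI[rotated 2])
qed

lemma RT_space_refinement:
  assumes "is_refinement \<T>' \<T>"
  shows "RT_space \<Omega> r \<T> \<subseteq> RT_space \<Omega> r \<T>'"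
proof
  fix \<tau> assume \<tau>: "\<tau> \<in> RT_space \<Omega> r \<T>"
  have "\<exists>v\<in>RT_shape r. AE x in lborel. x \<in> K' \<longrightarrow> rep_l2 \<tau> x = v x" if K': "K' \<in> \<T>'" for K'
  proof -
    obtain K where K: "K \<in> \<T>" "K' \<subseteq> K"
      using assms K' by (auto simp: is_refinement_def)
    obtain v where v: "v \<in> RT_shape r" "AE x in lborel. x \<in> K \<longrightarrow> rep_l2 \<tau> x = v x"
      using RT_spaceE[OF \<tau> K(1)] .
    from v(2) have "AE x in lborel. x \<in> K' \<longrightarrow> rep_l2 \<tau> x = v x"
      by eventually_elim (use K(2) in auto)
    then show ?thesis using v(1) by blast
  qed
  then show "\<tau> \<in> RT_space \<Omega> r \<T>'"
    using \<tau> by (auto simp: RT_space_def)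
qed

section \<open>The operators of the hierarchy and the two-sided estimate\<close>

context
  fixes \<Omega> :: "(real^'n) set" and V :: "(real^'n, real^'n) l2 set"
  assumes \<Omega>: "open \<Omega>" "bounded \<Omega>" and V: "finite_dim_subspace V" "V \<subseteq> H_div \<Omega>"
begin

text \<open>
  The vector representing the linear functional $\tau \mapsto (\sigma,\tau) +
  (\mathrm{div}\,\sigma,\mathrm{div}\,\tau)$ on \<open>V\<close> has the values of the functional on an
  orthonormal basis as coordinates.
\<close>

lemma Lam_mem_inner:
  assumes \<sigma>: "\<sigma> \<in> V"
  shows "Lam \<Omega> V \<sigma> \<in> V \<and>
    (\<forall>\<tau>\<in>V. Lam \<Omega> V \<sigma> \<bullet> \<tau> = \<sigma> \<bullet> \<tau> + weak_div \<Omega> \<sigma> \<bullet> weak_div \<Omega> \<tau>)"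
  unfolding Lam_def
proof (rule theI')
  obtain E where E: "onb E V"
    using V(1) by (rule finite_dim_subspace_onb)
  note subV = onb_subspace[OF E]
  let ?a = "\<lambda>\<tau>. \<sigma> \<bullet> \<tau> + weak_div \<Omega> \<sigma> \<bullet> weak_div \<Omega> \<tau>"
  have a_sum: "?a (\<Sum>e\<in>F. c e *\<^sub>R e) = (\<Sum>e\<in>F. c e * ?a e)" if "finite F" "F \<subseteq> V" for F c
    using that
  proof (induction F rule: finite_induct)
    case empty
    have "weak_div \<Omega> (0 *\<^sub>R \<sigma>) = 0 *\<^sub>R weak_div \<Omega> \<sigma>"
      using weak_div_scaleR[OF \<Omega>, of \<sigma> 0] \<sigma> V(2) by blast
    then show ?case by simp
  next
    case (insert e F)
    have "c e *\<^sub>R e \<in> V" "(\<Sum>e\<in>F. c e *\<^sub>R e) \<in> V"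
      using insert.prems by (auto intro!: subspace_sum subspace_scale subV)
    then have "weak_div \<Omega> (c e *\<^sub>R e + (\<Sum>e\<in>F. c e *\<^sub>R e))
        = weak_div \<Omega> (c e *\<^sub>R e) + weak_div \<Omega> (\<Sum>e\<in>F. c e *\<^sub>R e)"
      using V(2) by (intro weak_div_add \<Omega>) auto
    moreover have "weak_div \<Omega> (c e *\<^sub>R e) = c e *\<^sub>R weak_div \<Omega> e"
      using V(2) insert.prems by (intro weak_div_scaleR \<Omega>) auto
    ultimately show ?case
      using insert by (simp add: inner_add_right algebra_simps)
  qed
  let ?\<rho> = "\<Sum>e\<in>E. ?a e *\<^sub>R e"
  have "?\<rho> \<bullet> \<tau> = ?a \<tau>" if \<tau>: "\<tau> \<in> V" for \<tau>
  proof -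
    have "?\<rho> \<bullet> \<tau> = (\<Sum>e\<in>E. (\<tau> \<bullet> e) * ?a e)"
      unfolding onb_inner_expand[OF E \<tau>]
      by (intro sum.cong refl) (simp only: inner_orthonormal_sum[OF E] mult.commute)
    also have "\<dots> = ?a (\<Sum>e\<in>E. (\<tau> \<bullet> e) *\<^sub>R e)"
      by (rule a_sum[symmetric, OF onb_finite[OF E] onb_subset[OF E]])
    also have "\<dots> = ?a \<tau>"
      by (simp only: onb_expand[OF E \<tau>])
    finally show ?thesis .
  qed
  note inner_\<rho> = this
  have mem: "?\<rho> \<in> V"
    by (rule onb_sum_mem[OF E])
  show "\<exists>!\<rho>. \<rho> \<in> V \<and> (\<forall>\<tau>\<in>V. \<rho> \<bullet> \<tau> = ?a \<tau>)"
  proof (rule ex1I[of _ ?\<rho>])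
    show "?\<rho> \<in> V \<and> (\<forall>\<tau>\<in>V. ?\<rho> \<bullet> \<tau> = ?a \<tau>)"
      by (intro conjI ballI mem inner_\<rho>)
    fix \<rho>' assume *: "\<rho>' \<in> V \<and> (\<forall>\<tau>\<in>V. \<rho>' \<bullet> \<tau> = ?a \<tau>)"
    show "\<rho>' = ?\<rho>"
      by (rule inner_ext[OF subV conjunct1[OF *] mem])
        (simp only: inner_\<rho> bspec[OF conjunct2[OF *]])
  qed
qed

lemma Lam_mem: "\<sigma> \<in> V \<Longrightarrow> Lam \<Omega> V \<sigma> \<in> V"
  using Lam_mem_inner by blast

lemma inner_Lam:
  "\<sigma> \<in> V \<Longrightarrow> \<tau> \<in> V \<Longrightarrow> Lam \<Omega> V \<sigma> \<bullet> \<tau> = \<sigma> \<bullet> \<tau> + weak_div \<Omega> \<sigma> \<bullet> weak_div \<Omega> \<tau>"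
  using Lam_mem_inner by blast

lemma sym_pos_def_on_Lam: "sym_pos_def_on V (Lam \<Omega> V)"
proof -
  have subV: "subspace V"
    using V(1) subspace_span unfolding finite_dim_subspace_def by metis
  note H = subsetD[OF V(2)]
  have add: "Lam \<Omega> V (x + y) = Lam \<Omega> V x + Lam \<Omega> V y" if xy: "x \<in> V" "y \<in> V" for x y
  proof (rule inner_ext[OF subV])
    have xy': "x + y \<in> V" using xy by (rule subspace_add[OF subV])
    then show "Lam \<Omega> V (x + y) \<in> V" by (rule Lam_mem)
    show "Lam \<Omega> V x + Lam \<Omega> V y \<in> V" using xy by (intro subspace_add[OF subV] Lam_mem)
    show "Lam \<Omega> V (x + y) \<bullet> v = (Lam \<Omega> V x + Lam \<Omega> V y) \<bullet> v" if "v \<in> V" for v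
      using that xy xy' by (simp add: inner_Lam inner_add_left weak_div_add[OF \<Omega> H H])
  qed
  have scale: "Lam \<Omega> V (c *\<^sub>R x) = c *\<^sub>R Lam \<Omega> V x" if x: "x \<in> V" for c x
  proof (rule inner_ext[OF subV])
    have cx: "c *\<^sub>R x \<in> V" using x by (rule subspace_scale[OF subV])
    then show "Lam \<Omega> V (c *\<^sub>R x) \<in> V" by (rule Lam_mem)
    show "c *\<^sub>R Lam \<Omega> V x \<in> V" using x by (intro subspace_scale[OF subV] Lam_mem)
    show "Lam \<Omega> V (c *\<^sub>R x) \<bullet> v = (c *\<^sub>R Lam \<Omega> V x) \<bullet> v" if "v \<in> V" for v
      using that x cx by (simp add: inner_Lam weak_div_scaleR[OF \<Omega> H] distrib_left)
  qed
  have sym: "Lam \<Omega> V x \<bullet> y = x \<bullet> Lam \<Omega> V y" if "x \<in> V" "y \<in> V" for x y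
  proof -
    have "Lam \<Omega> V x \<bullet> y = Lam \<Omega> V y \<bullet> x"
      unfolding inner_Lam[OF that] inner_Lam[OF that(2,1)] by (simp only: inner_commute)
    then show ?thesis by (simp only: inner_commute[of x "Lam \<Omega> V y"])
  qed
  have pos: "0 < Lam \<Omega> V x \<bullet> x" if "x \<in> V" "x \<noteq> 0" for x
    unfolding inner_Lam[OF that(1,1)] using that(2) by (intro add_pos_nonneg) auto
  show ?thesis
    unfolding sym_pos_def_on_def by (intro conjI ballI allI impI Lam_mem add scale sym pos)
qed

end

text \<open>
  The equations are solved by $\Lambda_{k-1}^{-s}Q_{k-1}\Lambda_k^s\sigma$, and only by it because
  $\Lambda_{k-1}^s$ is positive definite.
\<close>

lemma P_op_mem_inner:
  assumes k: "\<not> k \<le> 1"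
    and W: "finite_dim_subspace (V (k - 1))" and spd: "sym_pos_def_on (V (k - 1)) (Lam \<Omega> (V (k - 1)))"
  shows "P_op \<Omega> V s k \<sigma> \<in> V (k - 1) \<and>
    (\<forall>\<tau>\<in>V (k - 1). Lam_pow \<Omega> (V (k - 1)) s (P_op \<Omega> V s k \<sigma>) \<bullet> \<tau> = Lam_pow \<Omega> (V k) s \<sigma> \<bullet> \<tau>)"
proof -
  let ?W = "V (k - 1)" and ?L = "Lam_pow \<Omega> (V (k - 1)) s"
  have L: "sym_pos_def_on ?W (Lam_pow \<Omega> ?W \<theta>)" for \<theta>
    unfolding Lam_pow_def by (rule sym_pos_def_on_frac_power[OF W spd])
  obtain E where E: "onb E ?W"
    using W by (rule finite_dim_subspace_onb)
  note subW = onb_subspace[OF E]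
  let ?q = "oproj ?W (Lam_pow \<Omega> (V k) s \<sigma>)"
  let ?\<rho> = "Lam_pow \<Omega> ?W (- s) ?q"
  have "?q \<in> ?W" by (rule oproj_mem[OF E])
  then have "?\<rho> \<in> ?W" "?L ?\<rho> = ?q"
    using sym_pos_def_on_mem[OF L] frac_power_frac_power_uminus[OF W spd]
    unfolding Lam_pow_def by auto
  then have \<rho>: "?\<rho> \<in> ?W \<and> (\<forall>\<tau>\<in>?W. ?L ?\<rho> \<bullet> \<tau> = Lam_pow \<Omega> (V k) s \<sigma> \<bullet> \<tau>)"
    using inner_oproj[OF E] by simp
  \<comment> \<open>two solutions differ by a vector of zero energy\<close>
  moreover have "\<rho>' = ?\<rho>" if "\<rho>' \<in> ?W \<and> (\<forall>\<tau>\<in>?W. ?L \<rho>' \<bullet> \<tau> = Lam_pow \<Omega> (V k) s \<sigma> \<bullet> \<tau>)" for \<rho>'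
  proof (rule ccontr)
    assume "\<rho>' \<noteq> ?\<rho>"
    then have d: "\<rho>' - ?\<rho> \<noteq> 0" by simp
    have dW: "\<rho>' - ?\<rho> \<in> ?W" using that \<rho> subspace_diff[OF subW] by blast
    have "?L (\<rho>' - ?\<rho>) \<bullet> (\<rho>' - ?\<rho>) = 0"
      using that \<rho> dW sym_pos_def_on_diff[OF L[of s] subW, of \<rho>' ?\<rho>] by (simp add: inner_diff_left)
    then show False
      using sym_pos_def_on_pos[OF L[of s] dW d] by simp
  qed
  ultimately have "\<exists>!\<rho>. \<rho> \<in> ?W \<and> (\<forall>\<tau>\<in>?W. ?L \<rho> \<bullet> \<tau> = Lam_pow \<Omega> (V k) s \<sigma> \<bullet> \<tau>)"
    by blast
  from theI'[OF this] show ?thesis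
    using k by (simp add: P_op_def)
qed

text \<open>
  The operators $\Lambda_k^s$ satisfy the assumptions of \<open>nested_forms\<close>: by \<open>inner_Lam\<close>, the
  forms of $\Lambda_{k-1}$ and $\Lambda_k$ coincide on $V_{k-1}$, so that
  \<open>frac_power_compression_le\<close> compares the energies of neighbouring levels.
\<close>

theorem theorem4p1:
  fixes \<Omega> :: "(real^'n) set"
    and \<T> :: "nat \<Rightarrow> (real^'n) set set"
    and V :: "nat \<Rightarrow> (real^'n, real^'n) l2 set"
    and R :: "nat \<Rightarrow> (real^'n, real^'n) l2 \<Rightarrow> (real^'n, real^'n) l2"
    and J r :: nat
    and \<kappa> \<gamma> s C\<^sub>1 C\<^sub>2 :: real
  assumes "bounded_polygonal_domain \<Omega>"
    and "1 \<le> J"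
    and "\<forall>k\<in>{1..J}. triangulation_of \<Omega> (\<T> k)"
    and "\<forall>k\<in>{1..J}. shape_regular \<kappa> (\<T> k)"
    and "\<forall>k\<in>{2..J}. is_refinement (\<T> k) (\<T> (k - 1))"
    and "1 \<le> \<gamma>"
    and "\<forall>k\<in>{2..J}. mesh_size (\<T> (k - 1)) \<le> \<gamma> * mesh_size (\<T> k)"
    and "\<forall>k\<in>{1..J}. V k = RT_space \<Omega> r (\<T> k)"
    and "s \<in> {0..1}"
    and "\<forall>k\<in>{1..J}. sym_pos_def_on (V k) (R k)"
    and "0 < C\<^sub>1" and "0 < C\<^sub>2"
    and "\<forall>k\<in>{1..J}. \<forall>\<tau>\<in>V k. R k \<tau> \<bullet> \<tau> \<le> C\<^sub>1 * (Lam_pow \<Omega> (V k) (- s) \<tau> \<bullet> \<tau>)"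
    and "\<forall>k\<in>{1..J}. \<forall>\<tau>\<in>V k.
           inv_into (V k) (R k) (\<tau> - P_op \<Omega> V s k \<tau>) \<bullet> (\<tau> - P_op \<Omega> V s k \<tau>)
             \<le> C\<^sub>2 * (Lam_pow \<Omega> (V k) s (\<tau> - P_op \<Omega> V s k \<tau>) \<bullet> (\<tau> - P_op \<Omega> V s k \<tau>))"
  shows "\<forall>\<tau>\<in>V J.
           inverse C\<^sub>2 * (Lam_pow \<Omega> (V J) s \<tau> \<bullet> \<tau>)
             \<le> B_op V R J (Lam_pow \<Omega> (V J) s \<tau>) \<bullet> Lam_pow \<Omega> (V J) s \<tau>
         \<and> B_op V R J (Lam_pow \<Omega> (V J) s \<tau>) \<bullet> Lam_pow \<Omega> (V J) s \<tau>
             \<le> C\<^sub>1 * real J * (Lam_pow \<Omega> (V J) s \<tau> \<bullet> \<tau>)"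
proof
  fix \<tau> assume \<tau>: "\<tau> \<in> V J"
  have \<Omega>: "open \<Omega>" "bounded \<Omega>"
    using assms(1) by (auto simp: bounded_polygonal_domain_def)
  have s: "0 \<le> s" "s \<le> 1" using assms(9) by auto
  have fd: "finite_dim_subspace (V k)" if "k \<in> {1..J}" for k
    using RT_space_finite_dim[OF \<Omega>] assms(3,8) that by auto
  have H: "V k \<subseteq> H_div \<Omega>" if "k \<in> {1..J}" for k
    using assms(8) that by (auto simp: RT_space_def)
  have nest: "V (k - 1) \<subseteq> V k" if "k \<in> {2..J}" for k
  proof -
    have "k \<in> {1..J}" "k - 1 \<in> {1..J}" using that by auto
    then show ?thesis
      using RT_space_refinement[of "\<T> k" "\<T> (k - 1)" \<Omega> r] assms(5,8) that by metis
  qed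
  have spd: "sym_pos_def_on (V k) (Lam \<Omega> (V k))" if "k \<in> {1..J}" for k
    by (rule sym_pos_def_on_Lam[OF \<Omega> fd[OF that] H[OF that]])
  interpret nested_forms V "\<lambda>k. Lam_pow \<Omega> (V k) s" J
  proof
    fix k
    show "finite_dim_subspace (V k)" if "k \<in> {1..J}" using fd that .
    show "V (k - 1) \<subseteq> V k" if "k \<in> {2..J}" using nest that .
    show "sym_pos_def_on (V k) (Lam_pow \<Omega> (V k) s)" if "k \<in> {1..J}"
      unfolding Lam_pow_def by (rule sym_pos_def_on_frac_power[OF fd[OF that] spd[OF that]])
    fix x assume k: "k \<in> {2..J}" and x: "x \<in> V (k - 1)"
    then have kk: "k \<in> {1..J}" "k - 1 \<in> {1..J}" by auto
    have "Lam \<Omega> (V (k - 1)) y \<bullet> y = Lam \<Omega> (V k) y \<bullet> y" if "y \<in> V (k - 1)" for y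
      using inner_Lam[OF \<Omega> fd H, of k y y] inner_Lam[OF \<Omega> fd H, of "k - 1" y y] that kk nest[OF k] by auto
    then show "Lam_pow \<Omega> (V k) s x \<bullet> x \<le> Lam_pow \<Omega> (V (k - 1)) s x \<bullet> x"
      unfolding Lam_pow_def
      by (intro frac_power_compression_le fd spd kk nest k s x)
  qed
  have "inverse C\<^sub>2 * (Lam_pow \<Omega> (V J) s \<tau> \<bullet> \<tau>)
      \<le> B_op V R J (Lam_pow \<Omega> (V J) s \<tau>) \<bullet> Lam_pow \<Omega> (V J) s \<tau>"
  proof (rule B_op_lower_bound[where P="P_op \<Omega> V s"])
    show "P_op \<Omega> V s 1 = (\<lambda>x. 0)"
      by (simp add: P_op_def fun_eq_iff)
    fix k x assume k: "k \<in> {2..J}"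
    then have "\<not> k \<le> 1" "k - 1 \<in> {1..J}" by auto
    note P = P_op_mem_inner[where V=V, OF this(1) fd[OF this(2)] spd[OF this(2)], of s x]
    then show "P_op \<Omega> V s k x \<in> V (k - 1)" by blast
    show "Lam_pow \<Omega> (V (k - 1)) s (P_op \<Omega> V s k x) \<bullet> y = Lam_pow \<Omega> (V k) s x \<bullet> y"
      if "y \<in> V (k - 1)" for y
      using P that by blast
  qed (use assms \<tau> in auto)
  moreover have "B_op V R J (Lam_pow \<Omega> (V J) s \<tau>) \<bullet> Lam_pow \<Omega> (V J) s \<tau>
      \<le> C\<^sub>1 * real J * (Lam_pow \<Omega> (V J) s \<tau> \<bullet> \<tau>)"
  proof (rule B_op_upper_bound[where M="\<lambda>k. Lam_pow \<Omega> (V k) (- s)"])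
    fix k y assume k: "k \<in> {1..J}" and y: "y \<in> V k"
    show "Lam_pow \<Omega> (V k) (- s) y \<in> V k \<and> Lam_pow \<Omega> (V k) s (Lam_pow \<Omega> (V k) (- s) y) = y"
      unfolding Lam_pow_def
      using sym_pos_def_on_mem[OF sym_pos_def_on_frac_power[OF fd[OF k] spd[OF k]] y]
        frac_power_frac_power_uminus[OF fd[OF k] spd[OF k] y] by blast
  qed (use assms \<tau> in auto)
  ultimately show "inverse C\<^sub>2 * (Lam_pow \<Omega> (V J) s \<tau> \<bullet> \<tau>)
             \<le> B_op V R J (Lam_pow \<Omega> (V J) s \<tau>) \<bullet> Lam_pow \<Omega> (V J) s \<tau>
         \<and> B_op V R J (Lam_pow \<Omega> (V J) s \<tau>) \<bullet> Lam_pow \<Omega> (V J) s \<tau>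
             \<le> C\<^sub>1 * real J * (Lam_pow \<Omega> (V J) s \<tau> \<bullet> \<tau>)"
    by blast
qed

end
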